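(* Let $X_t$, $t\ge0$, be an (anisotropic) stochastic process in $\mathbb{R}^d$ with stationary and independent increments (a Lévy process, with càdlàg paths), and let $D\subset\mathbb{R}^d$ be a bounded domain with $\mathrm{E}[\tau_D]<\infty$. (i) If $\mathrm{E}[X_t]=\mathbf c\,t$ for all $t\ge 0$, where $\mathbf c\in\mathbb{R}^d$ is a nonzero vector, then $$\mathrm{E}[\tau_D]=\frac{1}{|\mathbf c|}\left|\mathrm{E}[X_{\tau_D}]\right|.$$ (ii) If $\mathrm{E}\left[|X_t-\mathrm{E}[X_t]|^2\right]=Ct$ for all $t\ge0$, where $C\neq0$ is a constant (depending on the dimension $d$), then $$\mathrm{E}[\tau_D]=\frac1C\,\mathrm{E}\left[\left|X_{\tau_D}-\mathrm{E}[X_{\tau_D}]\right|^2\right].$$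
   Context: $\tau_D=\inf\{t>0:X_t\notin D\}$ is the first exit time from $D$. $\mathrm{E}$ applied to functions of $X_{\tau_D}$ denotes the average over space and time.
   Formalization: Part (ii) is false with drift (rate-1 Poisson process, D=(-1,1): E[τ_D]=1, but X_{τ_D}=1 has variance 0); it is proved with E[X_{τ_D}] replaced by the mean function t↦E[X_t] evaluated at t=τ_D, and as written when E[X_t]=0 for all t. *)

theory Defs
  imports "HOL-Probability.Probability"
begin

definition cadlag :: "(real \<Rightarrow> 'a::topological_space) \<Rightarrow> bool" where
  "cadlag f \<longleftrightarrow>
     (\<forall>t\<ge>0. (f \<longlongrightarrow> f t) (at_right t)) \<and>
     (\<forall>t>0. \<exists>l. (f \<longlongrightarrow> l) (at_left t))"

text \<open>
  The time set is the half-line of nonnegative reals; values of \<open>X\<close> at negative times are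
  irrelevant. Stochastic continuity is not listed, since it follows from stationarity of the
  increments and right-continuity of the paths.
\<close>

locale levy_process = prob_space M for M :: "'w measure" +
  fixes X :: "real \<Rightarrow> 'w \<Rightarrow> 'a::euclidean_space"
  assumes random_variables: "t \<ge> 0 \<Longrightarrow> X t \<in> borel_measurable M"
    and start_at_0: "AE \<omega> in M. X 0 \<omega> = 0"
    and independent_increments:
      "\<And>(t :: nat \<Rightarrow> real) n. 0 \<le> t 0 \<Longrightarrow> mono t \<Longrightarrow>
         indep_vars (\<lambda>_. borel) (\<lambda>i \<omega>. X (t (Suc i)) \<omega> - X (t i) \<omega>) {..<n}"
    and stationary_increments:
      "s \<ge> 0 \<Longrightarrow> h \<ge> 0 \<Longrightarrow>
         distr M borel (\<lambda>\<omega>. X (s + h) \<omega> - X s \<omega>) = distr M borel (\<lambda>\<omega>. X h \<omega> - X 0 \<omega>)"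
    and cadlag_paths: "\<omega> \<in> space M \<Longrightarrow> cadlag (\<lambda>t. X t \<omega>)"

text \<open>The exit time is \<open>\<infinity>\<close> (the infimum of the empty set) on paths that never leave \<open>D\<close>.\<close>

definition exit_time :: "(real \<Rightarrow> 'w \<Rightarrow> 'a) \<Rightarrow> 'a set \<Rightarrow> 'w \<Rightarrow> ennreal" where
  "exit_time X D \<omega> = (INF t\<in>{t. 0 < t \<and> X t \<omega> \<notin> D}. ennreal t)"

text \<open>
  The value of the process \<open>Y\<close> at the time when \<open>X\<close> leaves \<open>D\<close>; for \<open>Y = X\<close> this is the exit
  position. On paths with infinite exit time it is the junk value \<open>Y 0 \<omega>\<close>, which is harmless
  when the exit time is almost surely finite.
\<close>

definition at_exit :: "(real \<Rightarrow> 'w \<Rightarrow> 'a) \<Rightarrow> 'a set \<Rightarrow> (real \<Rightarrow> 'w \<Rightarrow> 'b) \<Rightarrow> 'w \<Rightarrow> 'b" where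
  "at_exit X D Y \<omega> = Y (enn2real (exit_time X D \<omega>)) \<omega>"

text \<open>
  The process minus its mean function. Its value at the exit time is the exit position minus
  the mean function evaluated at the random exit time, which differs from subtracting the
  constant mean of the exit position unless the process has mean zero. Only the former satisfies
  the second moment identity for processes with drift: for a Poisson process of rate 1 and the
  interval from -1 to 1, the exit position is constantly 1, so its variance is 0, but the mean
  exit time is 1.
\<close>

definition centred ::
  "'w measure \<Rightarrow> (real \<Rightarrow> 'w \<Rightarrow> 'a::euclidean_space) \<Rightarrow> real \<Rightarrow> 'w \<Rightarrow> 'a" where
  "centred M X t \<omega> = X t \<omega> - (\<integral>\<omega>'. X t \<omega>' \<partial>M)"

end

theory Submission
  imports Defs
begin

text \<open>
  The statement is Wald's pair of identities in continuous time. Let \<open>\<tau>\<close> be the exit time, and let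
  \<open>Z\<close> be the process \<open>X\<close> minus its mean function, so that \<open>Z\<close> has stationary, independent, centred
  increments. If \<open>\<tau>\<close> is an optional time (\<open>{\<tau> < t}\<close> belongs to the past at time \<open>t\<close>, up to null sets) of
  finite mean, then \<open>Z \<tau>\<close> has mean zero (\<open>wald_mean\<close>), and if moreover the mean of \<open>|Z t|\<^sup>2\<close> is \<open>C t\<close>,
  then the mean of \<open>|Z \<tau>|\<^sup>2\<close> is \<open>C\<close> times the mean of \<open>\<tau>\<close> (\<open>wald_second_moment\<close>). With
  \<open>Z t = X t - t c\<close> the first identity reads \<open>E X \<tau> = (E \<tau>) c\<close>.

  Both are proved by approximating \<open>\<tau>\<close> from the right by dyadic times \<open>T k\<close> with finitely many
  values. Then \<open>Z (T k)\<close> is a finite sum of increments, each weighted by an indicator from its past,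
  and the two identities for \<open>T k\<close> follow from independence. By right continuity \<open>Z (T k)\<close> converges to
  \<open>Z \<tau>\<close> everywhere, so only the exchange of limit and integral is at stake. For the second moment,
  \<open>E |Z (T k) - Z (T l)|\<^sup>2 = C E |T k - T l|\<close> shows that the approximations are Cauchy in mean square.
  For the mean, all \<open>|Z (T k)|\<close> are dominated by the sum over the integers \<open>i \<le> \<tau>\<close> of the oscillation of
  \<open>Z\<close> on \<open>[i, i + 1]\<close>; Ottaviani's inequality (\<open>ottaviani\<close>), conditioned on the event \<open>i \<le> \<tau>\<close> of the past,
  shows that this sum has finite mean.

  It remains to see that the exit time is optional (\<open>exit_time_optional\<close>). The complement \<open>K\<close> of \<open>D\<close> is
  closed, and the path may reach \<open>K\<close> at a single instant, so countably many times do not decide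
  whether it does. They do decide whether the path enters each neighbourhood of \<open>K\<close> in a time interval.
  If it enters all of them, the entrance times increase to a limit \<open>\<sigma>\<close>, and \<open>Z \<sigma>\<close> lies in \<open>K\<close> almost surely:
  otherwise the process would move a fixed distance in an arbitrarily short time after an entrance
  time, which Ottaviani's inequality makes improbable (\<open>hitting_closed_set\<close>). This is
  quasi-left-continuity of the process.
\<close>

section \<open>Null sets and dyadic approximation\<close>

text \<open>The set of all \<open>\<omega>\<close> with \<open>P \<omega>\<close> is not required to be measurable.\<close>

lemma AE_not_if_small_cover:
  fixes M :: "'w measure"
  assumes "\<And>e. e > 0 \<Longrightarrow> \<exists>N\<in>sets M. emeasure M N \<le> ennreal e \<and> (\<forall>\<omega>\<in>space M. P \<omega> \<longrightarrow> \<omega> \<in> N)"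
  shows "AE \<omega> in M. \<not> P \<omega>"
proof -
  have "\<forall>n::nat. \<exists>N\<in>sets M. emeasure M N \<le> ennreal (1 / Suc n) \<and> (\<forall>\<omega>\<in>space M. P \<omega> \<longrightarrow> \<omega> \<in> N)"
    using assms by simp
  then obtain N where N: "\<And>n. N n \<in> sets M" "\<And>n. emeasure M (N n) \<le> ennreal (1 / Suc n)"
      "\<And>n \<omega>. \<omega> \<in> space M \<Longrightarrow> P \<omega> \<Longrightarrow> \<omega> \<in> N n"
    by metis
  have le: "emeasure M (\<Inter>n. N n) \<le> ennreal (1 / Suc n)" for n
    by (rule order_trans[OF emeasure_mono N(2)[of n]]) (use N(1) in auto)
  have "emeasure M (\<Inter>n. N n) \<le> ennreal 0"
  proof (rule tendsto_lowerbound)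
    show "(\<lambda>n. ennreal (1 / Suc n)) \<longlonglongrightarrow> ennreal 0"
      using LIMSEQ_inverse_real_of_nat by (intro tendsto_ennrealI) (simp add: inverse_eq_divide)
  qed (use le in auto)
  then have "(\<Inter>n. N n) \<in> null_sets M"
    using N(1) by (auto simp: null_sets_def)
  then show ?thesis
    by (rule AE_I') (use N(3) in auto)
qed

text \<open>
  The index of the first point of the grid of mesh \<open>2\<^sup>-\<^sup>k\<close> strictly to the right of \<open>u\<close>, for \<open>u \<ge> 0\<close>.
  Strictness makes the grid points approach \<open>u\<close> within \<open>at_right u\<close>.
\<close>

definition dyadic_above :: "nat \<Rightarrow> real \<Rightarrow> nat" where
  "dyadic_above k u = nat \<lfloor>u * 2 ^ k\<rfloor> + 1"

lemma dyadic_above_gt: "u < real (dyadic_above k u) / 2 ^ k"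
proof -
  have "u * 2 ^ k < real (dyadic_above k u)"
    unfolding dyadic_above_def by linarith
  then show ?thesis by (simp add: field_simps)
qed

lemma dyadic_above_le:
  assumes "0 \<le> u" shows "real (dyadic_above k u) / 2 ^ k \<le> u + 1 / 2 ^ k"
proof -
  have "real (dyadic_above k u) \<le> u * 2 ^ k + 1"
    unfolding dyadic_above_def using assms by (simp add: of_nat_floor)
  then show ?thesis by (simp add: field_simps)
qed

lemma dyadic_above_le_iff:
  assumes "0 \<le> u" shows "dyadic_above k u \<le> j \<longleftrightarrow> u < real j / 2 ^ k"
proof -
  have "dyadic_above k u \<le> j \<longleftrightarrow> u * 2 ^ k < real j"
    unfolding dyadic_above_def using assms
    by (metis Suc_eq_plus1 Suc_le_eq floor_less_iff nat_less_iff of_int_of_nat_eq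
        floor_mono mult_nonneg_nonneg zero_le_floor zero_le_numeral zero_le_power)
  then show ?thesis by (simp add: field_simps)
qed

lemma dyadic_above_tendsto:
  assumes "0 \<le> u"
  shows "filterlim (\<lambda>k. real (dyadic_above k u) / 2 ^ k) (at_right u) sequentially"
proof -
  have "(\<lambda>k. real (dyadic_above k u) / 2 ^ k) \<longlonglongrightarrow> u"
  proof (rule tendsto_sandwich[where f = "\<lambda>_. u" and h = "\<lambda>k. u + 1 / 2 ^ k"])
    show "(\<lambda>k. u + 1 / 2 ^ k) \<longlonglongrightarrow> u"
      using tendsto_add[OF tendsto_const LIMSEQ_realpow_zero[of "1/2"], of u]
      by (simp add: power_divide)
    show "eventually (\<lambda>k. real (dyadic_above k u) / 2 ^ k \<le> u + 1 / 2 ^ k) sequentially"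
      using dyadic_above_le[OF assms] by simp
    show "eventually (\<lambda>k. u \<le> real (dyadic_above k u) / 2 ^ k) sequentially"
      by (intro always_eventually allI less_imp_le dyadic_above_gt)
  qed simp
  then show ?thesis
    using dyadic_above_gt[of u] by (auto simp: filterlim_at intro!: always_eventually) (metis less_irrefl)
qed

section \<open>Adapted processes with stationary independent increments\<close>

text \<open>
  A right-continuous process \<open>Z\<close> started at 0, adapted to an increasing family \<open>F\<close> of
  sub-sigma-algebras (measures of which only the space and the measurable sets matter), whose
  increment over an interval is independent of the past at its left end point and has a law that
  depends only on the length of the interval. \<open>F t\<close> is closed under almost sure equality of events,
  so that an event equal to one of the past up to a null set belongs to the past.
\<close>

locale adapted_increments = prob_space M for M :: "'w measure" +
  fixes F :: "real \<Rightarrow> 'w measure" and Z :: "real \<Rightarrow> 'w \<Rightarrow> 'a::euclidean_space"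
  assumes subalg: "0 \<le> t \<Longrightarrow> subalgebra M (F t)"
    and F_mono: "0 \<le> s \<Longrightarrow> s \<le> t \<Longrightarrow> sets (F s) \<subseteq> sets (F t)"
    and F_complete: "0 \<le> t \<Longrightarrow> A \<in> sets M \<Longrightarrow> B \<in> sets (F t) \<Longrightarrow>
          (AE \<omega> in M. \<omega> \<in> A \<longleftrightarrow> \<omega> \<in> B) \<Longrightarrow> A \<in> sets (F t)"
    and adapted: "0 \<le> t \<Longrightarrow> Z t \<in> borel_measurable (F t)"
    and indep_past: "0 \<le> s \<Longrightarrow> s \<le> t \<Longrightarrow> A \<in> sets (F s) \<Longrightarrow> C \<in> sets borel \<Longrightarrow>
          prob (A \<inter> {\<omega>\<in>space M. Z t \<omega> - Z s \<omega> \<in> C}) =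
          prob A * prob {\<omega>\<in>space M. Z t \<omega> - Z s \<omega> \<in> C}"
    and stationary: "0 \<le> s \<Longrightarrow> 0 \<le> h \<Longrightarrow>
          distr M borel (\<lambda>\<omega>. Z (s + h) \<omega> - Z s \<omega>) = distr M borel (Z h)"
    and start_0: "\<omega> \<in> space M \<Longrightarrow> Z 0 \<omega> = 0"
    and right_cont: "\<omega> \<in> space M \<Longrightarrow> 0 \<le> t \<Longrightarrow> ((\<lambda>u. Z u \<omega>) \<longlongrightarrow> Z t \<omega>) (at_right t)"
begin

lemma space_F [simp]: "0 \<le> t \<Longrightarrow> space (F t) = space M"
  using subalg by (auto simp: subalgebra_def)

lemma sets_F_subset: "0 \<le> t \<Longrightarrow> A \<in> sets (F t) \<Longrightarrow> A \<in> sets M"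
  using subalg by (auto simp: subalgebra_def)

lemma measurable_F_mono:
  "0 \<le> s \<Longrightarrow> s \<le> t \<Longrightarrow> f \<in> measurable (F s) N \<Longrightarrow> f \<in> measurable (F t) N"
  using measurable_mono[OF order_refl refl F_mono[of s t] _, of N] by auto

lemma measurable_F_M: "0 \<le> s \<Longrightarrow> f \<in> measurable (F s) N \<Longrightarrow> f \<in> measurable M N"
  using measurable_mono[OF order_refl refl, of "F s" M N] subalg[of s]
  by (auto simp: subalgebra_def)

lemma adapted_mono: "0 \<le> s \<Longrightarrow> s \<le> t \<Longrightarrow> Z s \<in> borel_measurable (F t)"
  by (rule measurable_F_mono[OF _ _ adapted])

lemma Z_measurable [measurable]: "0 \<le> t \<Longrightarrow> Z t \<in> borel_measurable M"
  by (rule measurable_F_M[OF _ adapted])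

lemma distr_increment:
  assumes "0 \<le> s" "s \<le> t"
  shows "distr M borel (\<lambda>\<omega>. Z t \<omega> - Z s \<omega>) = distr M borel (Z (t - s))"
  using stationary[of s "t - s"] assms by simp

lemma prob_increment:
  assumes "0 \<le> s" "s \<le> t" "B \<in> sets borel"
  shows "prob {\<omega>\<in>space M. Z t \<omega> - Z s \<omega> \<in> B} = prob {\<omega>\<in>space M. Z (t - s) \<omega> \<in> B}"
proof -
  have "measure (distr M borel (\<lambda>\<omega>. Z t \<omega> - Z s \<omega>)) B = measure (distr M borel (Z (t - s))) B"
    by (simp add: distr_increment assms)
  moreover have "(\<lambda>\<omega>. Z t \<omega> - Z s \<omega>) \<in> borel_measurable M" "Z (t - s) \<in> borel_measurable M"
    using assms by auto
  ultimately show ?thesis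
    using assms(3) by (simp add: measure_distr vimage_def Int_def conj_commute)
qed

text \<open>
  Ottaviani's inequality, conditioned on an event \<open>A\<close> of the past: at the first time \<open>t j\<close> with
  \<open>|Z (t j) - Z (t 0)| > a + b\<close>, the remaining increment up to \<open>t n\<close> is independent of what has
  happened, and with probability at least 1/2 it is too small to bring the process back within
  distance \<open>a\<close>.
\<close>

lemma ottaviani:
  fixes t :: "nat \<Rightarrow> real"
  assumes t: "0 \<le> t 0" "mono t" and A: "A \<in> sets (F (t 0))"
    and half: "\<And>j. j \<le> n \<Longrightarrow> prob {\<omega>\<in>space M. norm (Z (t n) \<omega> - Z (t j) \<omega>) > b} \<le> 1 / 2"
  shows "prob (A \<inter> {\<omega>\<in>space M. \<exists>j\<le>n. norm (Z (t j) \<omega> - Z (t 0) \<omega>) > a + b})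
    \<le> 2 * prob A * prob {\<omega>\<in>space M. norm (Z (t n - t 0) \<omega>) > a}"
proof -
  have t0: "0 \<le> t j" for j using t monoD[OF t(2), of 0 j] by auto
  have tj: "t i \<le> t j" if "i \<le> j" for i j using that t(2) by (auto dest: monoD)
  \<comment> \<open>\<open>A' j\<close>: the threshold is first passed at time \<open>t j\<close>\<close>
  define A' where "A' j = A \<inter> {\<omega>\<in>space M. norm (Z (t j) \<omega> - Z (t 0) \<omega>) > a + b \<and>
      (\<forall>i<j. norm (Z (t i) \<omega> - Z (t 0) \<omega>) \<le> a + b)}" for j
  define S where "S = A \<inter> {\<omega>\<in>space M. norm (Z (t n) \<omega> - Z (t 0) \<omega>) > a}"
  define G where "G j = {\<omega>\<in>space M. norm (Z (t n) \<omega> - Z (t j) \<omega>) \<le> b}" for j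
  have [measurable]: "Z (t j) \<in> borel_measurable M" for j using t0 by simp
  have AM [measurable]: "A \<in> sets M" using A sets_F_subset t(1) by auto
  have A'F: "A' j \<in> sets (F (t j))" for j
  proof -
    have *: "Z (t i) \<in> borel_measurable (F (t j))" if "i \<le> j" for i
      using adapted_mono[OF t0 tj[OF that]] .
    have "A \<in> sets (F (t j))" using A F_mono[OF t0 tj[of 0 j]] by auto
    moreover have "{\<omega>\<in>space (F (t j)). norm (Z (t i) \<omega> - Z (t 0) \<omega>) \<le> a + b} \<in> sets (F (t j))"
      if "i < j" for i
    proof -
      note [measurable] = *[OF less_imp_le[OF that]] *[of 0, simplified]
      show ?thesis by measurable
    qed
    moreover have "{\<omega>\<in>space (F (t j)). norm (Z (t j) \<omega> - Z (t 0) \<omega>) > a + b} \<in> sets (F (t j))"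
    proof -
      note [measurable] = *[OF order_refl] *[of 0, simplified]
      show ?thesis by measurable
    qed
    ultimately have "A \<inter> {\<omega>\<in>space (F (t j)). norm (Z (t j) \<omega> - Z (t 0) \<omega>) > a + b \<and>
      (\<forall>i\<in>{..<j}. norm (Z (t i) \<omega> - Z (t 0) \<omega>) \<le> a + b)} \<in> sets (F (t j))" (is "?X \<in> _")
      by (intro sets.Int sets.sets_Collect_conj sets.sets_Collect_finite_All) auto
    moreover have "A' j = ?X" unfolding A'_def space_F[OF t0] by auto
    ultimately show ?thesis by simp
  qed
  have A'M [measurable]: "A' j \<in> sets M" for j using A'F sets_F_subset t0 by blast
  have SM [measurable]: "S \<in> sets M" unfolding S_def by measurable
  have GM [measurable]: "G j \<in> sets M" for j unfolding G_def by measurable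
  have disj: "disjoint_family_on A' {..n}"
  proof -
    have "A' i \<inter> A' j = {}" if "i < j" for i j using that by (auto simp: A'_def)
    then show ?thesis
      unfolding disjoint_family_on_def by (metis inf_commute linorder_neqE_nat)
  qed
  have cover: "A \<inter> {\<omega>\<in>space M. \<exists>j\<le>n. norm (Z (t j) \<omega> - Z (t 0) \<omega>) > a + b} \<subseteq> (\<Union>j\<le>n. A' j)"
  proof
    fix \<omega> assume \<omega>: "\<omega> \<in> A \<inter> {\<omega>\<in>space M. \<exists>j\<le>n. norm (Z (t j) \<omega> - Z (t 0) \<omega>) > a + b}"
    define P where "P j \<longleftrightarrow> norm (Z (t j) \<omega> - Z (t 0) \<omega>) > a + b" for j
    from \<omega> obtain j where j: "j \<le> n" "P j" by (auto simp: P_def)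
    have "P (LEAST j. P j)" "(LEAST j. P j) \<le> n"
      using j by (auto intro: LeastI Least_le le_trans)
    moreover have "\<not> P i" if "i < (LEAST j. P j)" for i using that by (rule not_less_Least)
    ultimately have "\<omega> \<in> A' (LEAST j. P j)" using \<omega> by (auto simp: A'_def P_def not_less)
    with \<open>(LEAST j. P j) \<le> n\<close> show "\<omega> \<in> (\<Union>j\<le>n. A' j)" by auto
  qed
  have half': "1 / 2 \<le> prob (G j)" if "j \<le> n" for j
  proof -
    have "prob (G j) = 1 - prob {\<omega>\<in>space M. norm (Z (t n) \<omega> - Z (t j) \<omega>) > b}"
      by (subst prob_compl[symmetric]) (auto simp: G_def intro!: arg_cong[where f = prob])
    then show ?thesis using half[OF that] by simp
  qed
  have "prob (A' j) \<le> 2 * prob (A' j \<inter> G j)" if "j \<le> n" for j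
  proof -
    have "prob (A' j \<inter> G j) = prob (A' j) * prob (G j)"
      using indep_past[OF t0 tj[OF that] A'F[of j], of "cball 0 b"] by (simp add: G_def)
    moreover have "prob (A' j) * (1 / 2) \<le> prob (A' j) * prob (G j)"
      using half'[OF that] by (intro mult_left_mono) auto
    ultimately show ?thesis by simp
  qed
  moreover have "prob (A' j \<inter> G j) \<le> prob (A' j \<inter> S)" for j
  proof (intro finite_measure_mono)
    show "A' j \<inter> G j \<subseteq> A' j \<inter> S"
    proof
      fix \<omega> assume \<omega>: "\<omega> \<in> A' j \<inter> G j"
      then have "norm (Z (t j) \<omega> - Z (t 0) \<omega>) > a + b" "norm (Z (t n) \<omega> - Z (t j) \<omega>) \<le> b"
        by (auto simp: A'_def G_def)
      moreover have "norm (Z (t j) \<omega> - Z (t 0) \<omega>) \<le>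
          norm (Z (t n) \<omega> - Z (t 0) \<omega>) + norm (Z (t n) \<omega> - Z (t j) \<omega>)"
        using norm_triangle_ineq4[of "Z (t n) \<omega> - Z (t 0) \<omega>" "Z (t n) \<omega> - Z (t j) \<omega>"]
        by (simp add: algebra_simps)
      ultimately show "\<omega> \<in> A' j \<inter> S" using \<omega> by (auto simp: S_def A'_def)
    qed
  qed auto
  ultimately have le: "prob (A' j) \<le> 2 * prob (A' j \<inter> S)" if "j \<le> n" for j
    using that by (meson order_trans mult_left_mono zero_le_numeral)
  have "prob (A \<inter> {\<omega>\<in>space M. \<exists>j\<le>n. norm (Z (t j) \<omega> - Z (t 0) \<omega>) > a + b})
      \<le> prob (\<Union>j\<le>n. A' j)"
    by (intro finite_measure_mono cover) auto
  also have "\<dots> = (\<Sum>j\<le>n. prob (A' j))"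
    by (rule finite_measure_finite_Union) (use disj in auto)
  also have "\<dots> \<le> (\<Sum>j\<le>n. 2 * prob (A' j \<inter> S))"
    by (intro sum_mono le) auto
  also have "\<dots> = 2 * prob (\<Union>j\<le>n. A' j \<inter> S)"
  proof -
    have "disjoint_family_on (\<lambda>j. A' j \<inter> S) {..n}"
      using disj by (auto simp: disjoint_family_on_def)
    then have "prob (\<Union>j\<le>n. A' j \<inter> S) = (\<Sum>j\<le>n. prob (A' j \<inter> S))"
      by (intro finite_measure_finite_Union) auto
    then show ?thesis by (simp add: sum_distrib_left)
  qed
  also have "\<dots> \<le> 2 * prob S"
    by (intro mult_left_mono finite_measure_mono) auto
  also have "prob S = prob A * prob {\<omega>\<in>space M. norm (Z (t n - t 0) \<omega>) > a}"
    using indep_past[OF t(1) tj[of 0 n] A, of "- cball 0 a"] prob_increment[OF t(1) tj[of 0 n], of "- cball 0 a"]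
    by (simp add: S_def not_le)
  finally show ?thesis by (simp add: mult.assoc)
qed

text \<open>
  The event that the process oscillates by more than \<open>c\<close> on the interval from \<open>s\<close> to \<open>s + d\<close>;
  by right continuity it suffices to look at the points dividing the interval into \<open>2\<^sup>k\<close> equal parts.
\<close>

definition osc :: "real \<Rightarrow> real \<Rightarrow> real \<Rightarrow> 'w set" where
  "osc s d c = (\<Union>k. {\<omega>\<in>space M. \<exists>j\<le>2 ^ k. norm (Z (s + d * (real j / 2 ^ k)) \<omega> - Z s \<omega>) > c})"

lemma osc_sets [measurable]: "0 \<le> s \<Longrightarrow> 0 \<le> d \<Longrightarrow> osc s d c \<in> sets M"
proof -
  assume "0 \<le> s" "0 \<le> d"
  then have [measurable]: "Z s \<in> borel_measurable M"
    "Z (s + d * (real j / 2 ^ k)) \<in> borel_measurable M" for j k by simp_all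
  show ?thesis unfolding osc_def by measurable
qed

lemma tendsto_dyadic:
  assumes "\<omega> \<in> space M" "0 \<le> u" "0 \<le> s" "0 < d"
  shows "(\<lambda>k. Z (s + d * (real (dyadic_above k u) / 2 ^ k)) \<omega>) \<longlonglongrightarrow> Z (s + d * u) \<omega>"
proof -
  have "filterlim (\<lambda>v. s + d * v) (at_right (s + d * u)) (at_right u)"
    unfolding filterlim_at using assms
    by (auto intro!: tendsto_eq_intros simp: eventually_at_filter)
  then have "filterlim (\<lambda>k. s + d * (real (dyadic_above k u) / 2 ^ k)) (at_right (s + d * u)) sequentially"
    by (rule filterlim_compose[OF _ dyadic_above_tendsto[OF assms(2)]])
  then show ?thesis
    by (rule filterlim_compose[OF right_cont, rotated 2]) (use assms in auto)
qed

lemma norm_le_if_not_osc: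
  assumes "\<omega> \<in> space M" "0 \<le> s" "0 < d" "\<omega> \<notin> osc s d c" "s \<le> u" "u \<le> s + d"
  shows "norm (Z u \<omega> - Z s \<omega>) \<le> c"
proof (cases "u = s + d")
  case True
  have "norm (Z (s + d * (real (2 ^ 0) / 2 ^ 0)) \<omega> - Z s \<omega>) \<le> c"
    using assms unfolding osc_def by (force simp: not_less simp del: power_0)
  then show ?thesis using True by simp
next
  case False
  define v where "v = (u - s) / d"
  have v: "0 \<le> v" "v < 1" "u = s + d * v" using assms False by (auto simp: v_def field_simps)
  have "norm (Z (s + d * (real (dyadic_above k v) / 2 ^ k)) \<omega> - Z s \<omega>) \<le> c" for k
  proof -
    have "dyadic_above k v \<le> 2 ^ k" using v by (simp add: dyadic_above_le_iff)
    then show ?thesis using assms unfolding osc_def by (auto simp: not_less)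
  qed
  moreover have "(\<lambda>k. norm (Z (s + d * (real (dyadic_above k v) / 2 ^ k)) \<omega> - Z s \<omega>))
      \<longlonglongrightarrow> norm (Z u \<omega> - Z s \<omega>)"
    unfolding v(3) by (intro tendsto_intros tendsto_dyadic) (use assms v in auto)
  ultimately show ?thesis by (intro LIMSEQ_le_const2) auto
qed

lemma ottaviani_osc:
  assumes s: "0 \<le> s" and d: "0 < d" and A: "A \<in> sets (F s)"
    and half: "\<And>v. 0 \<le> v \<Longrightarrow> v \<le> d \<Longrightarrow> prob {\<omega>\<in>space M. norm (Z v \<omega>) > b} \<le> 1 / 2"
  shows "prob (A \<inter> osc s d (a + b)) \<le> 2 * prob A * prob {\<omega>\<in>space M. norm (Z d \<omega>) > a}"
proof -
  have AM [measurable]: "A \<in> sets M" using A s sets_F_subset by blast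
  define O' where "O' k = {\<omega>\<in>space M. \<exists>j\<le>2 ^ k. norm (Z (s + d * (real j / 2 ^ k)) \<omega> - Z s \<omega>) > a + b}" for k
  have O'M [measurable]: "O' k \<in> sets M" for k
  proof -
    have [measurable]: "Z s \<in> borel_measurable M"
      "Z (s + d * (real j / 2 ^ k)) \<in> borel_measurable M" for j k using s d by simp_all
    show ?thesis unfolding O'_def by measurable
  qed
  have "incseq O'"
  proof (rule incseq_SucI, rule subsetI)
    fix k \<omega> assume "\<omega> \<in> O' k"
    then obtain j where j: "\<omega> \<in> space M" "j \<le> 2 ^ k" "norm (Z (s + d * (real j / 2 ^ k)) \<omega> - Z s \<omega>) > a + b"
      by (auto simp: O'_def)
    have "s + d * (real (2 * j) / 2 ^ Suc k) = s + d * (real j / 2 ^ k)" by simp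
    then show "\<omega> \<in> O' (Suc k)" unfolding O'_def using j
      by (intro CollectI conjI exI[of _ "2 * j"]) auto
  qed
  then have "incseq (\<lambda>k. A \<inter> O' k)" by (auto simp: incseq_def)
  then have lim: "(\<lambda>k. prob (A \<inter> O' k)) \<longlonglongrightarrow> prob (\<Union>k. A \<inter> O' k)"
    by (intro finite_Lim_measure_incseq) auto
  have le: "prob (A \<inter> O' k) \<le> 2 * prob A * prob {\<omega>\<in>space M. norm (Z d \<omega>) > a}" for k
  proof -
    define t where "t j = s + d * (real j / 2 ^ k)" for j
    have "mono t" unfolding t_def mono_def using d by (auto intro!: mult_left_mono divide_right_mono)
    have tn: "t (2 ^ k) = s + d" "t 0 = s" by (auto simp: t_def)
    have "prob {\<omega>\<in>space M. norm (Z (t (2 ^ k)) \<omega> - Z (t j) \<omega>) > b} \<le> 1 / 2" if "j \<le> 2 ^ k" for j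
    proof -
      have 0: "0 \<le> t j" "t j \<le> t (2 ^ k)" "s \<le> t j"
        using monoD[OF \<open>mono t\<close> that] monoD[OF \<open>mono t\<close>, of 0 j] tn s by auto
      show ?thesis
        using prob_increment[OF 0(1,2), of "- cball 0 b"] half[of "t (2 ^ k) - t j"] 0 tn by (simp add: not_le)
    qed
    then show ?thesis
      using ottaviani[of t A "2 ^ k" b a] \<open>mono t\<close> A s tn by (simp add: O'_def t_def)
  qed
  have eq: "A \<inter> osc s d (a + b) = (\<Union>k. A \<inter> O' k)" unfolding osc_def O'_def by auto
  show ?thesis unfolding eq by (rule LIMSEQ_le_const2[OF lim]) (use le in auto)
qed

lemma stochastic_continuity:
  assumes a: "0 < a" and e: "0 < e"
  shows "\<exists>d>0. \<forall>v. 0 \<le> v \<and> v \<le> d \<longrightarrow> prob {\<omega>\<in>space M. norm (Z v \<omega>) > a} \<le> e"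
proof -
  have "eventually (\<lambda>v. prob {\<omega>\<in>space M. norm (Z v \<omega>) > a} \<le> e) (at_right 0)"
  proof (rule sequentially_imp_eventually_at_right[of 0 1])
    fix f :: "nat \<Rightarrow> real"
    assume f: "\<And>n. 0 < f n" "\<And>n. f n < 1" "decseq f" "f \<longlonglongrightarrow> 0"
    define g :: "nat \<Rightarrow> 'w \<Rightarrow> real" where "g n = indicator {\<omega>\<in>space M. norm (Z (f n) \<omega>) > a}" for n
    have [measurable]: "Z (f n) \<in> borel_measurable M" for n using f(1)[of n] by simp
    have [measurable]: "g n \<in> borel_measurable M" for n
      unfolding g_def by measurable
    have "(\<lambda>n. integral\<^sup>L M (g n)) \<longlonglongrightarrow> integral\<^sup>L M (\<lambda>_. 0)"
    proof (rule integral_dominated_convergence[where w = "\<lambda>_. 1"])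
      show "AE \<omega> in M. (\<lambda>n. g n \<omega>) \<longlonglongrightarrow> 0"
      proof (rule AE_I2)
        fix \<omega> assume \<omega>: "\<omega> \<in> space M"
        have "filterlim f (at_right 0) sequentially"
          using f by (auto simp: filterlim_at intro!: always_eventually) (metis less_irrefl)
        then have "(\<lambda>n. Z (f n) \<omega>) \<longlonglongrightarrow> Z 0 \<omega>"
          by (rule filterlim_compose[OF right_cont[OF \<omega> order_refl]])
        then have "(\<lambda>n. norm (Z (f n) \<omega>)) \<longlonglongrightarrow> 0"
          using tendsto_norm_zero start_0[OF \<omega>] by auto
        then have "eventually (\<lambda>n. norm (Z (f n) \<omega>) < a) sequentially"
          using a by (rule order_tendstoD)
        then have "eventually (\<lambda>n. g n \<omega> = 0) sequentially"
          by eventually_elim (auto simp: g_def)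
        then show "(\<lambda>n. g n \<omega>) \<longlonglongrightarrow> 0" by (rule tendsto_eventually)
      qed
    qed (auto simp: g_def indicator_def)
    then have "(\<lambda>n. prob {\<omega>\<in>space M. norm (Z (f n) \<omega>) > a}) \<longlonglongrightarrow> 0"
      unfolding g_def by simp
    then have "eventually (\<lambda>n. prob {\<omega>\<in>space M. norm (Z (f n) \<omega>) > a} < e) sequentially"
      using e by (rule order_tendstoD)
    then show "eventually (\<lambda>n. prob {\<omega>\<in>space M. norm (Z (f n) \<omega>) > a} \<le> e) sequentially"
      by eventually_elim simp
  qed simp
  then obtain d where d: "d > 0" "\<And>v. 0 < v \<Longrightarrow> v < d \<Longrightarrow> prob {\<omega>\<in>space M. norm (Z v \<omega>) > a} \<le> e"
    using eventually_at_right[of "0::real" 1] by auto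
  have "{\<omega>\<in>space M. norm (Z 0 \<omega>) > a} = {}" using a start_0 by auto
  then have 0: "prob {\<omega>\<in>space M. norm (Z 0 \<omega>) > a} = 0" by (simp only: measure_empty)
  show ?thesis
  proof (intro exI[of _ "d / 2"] conjI allI impI)
    fix v assume "0 \<le> v \<and> v \<le> d / 2"
    then show "prob {\<omega>\<in>space M. norm (Z v \<omega>) > a} \<le> e"
      using d e 0 by (cases "v = 0") auto
  qed (use d in auto)
qed

end

section \<open>Exit times are optional\<close>

context adapted_increments
begin

text \<open>
  The disjoint events \<open>A j\<close> stand for a random time taking the value \<open>t j\<close> on \<open>A j\<close>: a large oscillation
  just after such a time is no more likely than one after time 0.
\<close>

lemma prob_osc_after_simple_time:
  fixes J :: "nat set"
  assumes J: "finite J" "disjoint_family_on A J" and t: "\<And>j. j \<in> J \<Longrightarrow> 0 \<le> t j"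
    and A: "\<And>j. j \<in> J \<Longrightarrow> A j \<in> sets (F (t j))" and d: "0 < d"
    and half: "\<And>v. 0 \<le> v \<Longrightarrow> v \<le> d \<Longrightarrow> prob {\<omega>\<in>space M. norm (Z v \<omega>) > b} \<le> 1 / 2"
  shows "prob (\<Union>j\<in>J. A j \<inter> osc (t j) d (a + b)) \<le> 2 * prob {\<omega>\<in>space M. norm (Z d \<omega>) > a}"
proof -
  let ?p = "prob {\<omega>\<in>space M. norm (Z d \<omega>) > a}"
  have AM: "A j \<in> sets M" if "j \<in> J" for j using A[OF that] t[OF that] sets_F_subset by blast
  have "prob (\<Union>j\<in>J. A j \<inter> osc (t j) d (a + b)) \<le> (\<Sum>j\<in>J. prob (A j \<inter> osc (t j) d (a + b)))"
    by (rule finite_measure_subadditive_finite) (use J AM t d in auto)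
  also have "\<dots> \<le> (\<Sum>j\<in>J. 2 * prob (A j) * ?p)"
    by (intro sum_mono ottaviani_osc t A d half)
  also have "\<dots> = 2 * (\<Sum>j\<in>J. prob (A j)) * ?p"
    by (simp add: sum_distrib_left sum_distrib_right)
  also have "(\<Sum>j\<in>J. prob (A j)) = prob (\<Union>j\<in>J. A j)"
    by (rule finite_measure_finite_Union[symmetric]) (use J AM in auto)
  also have "2 * prob (\<Union>j\<in>J. A j) * ?p \<le> 2 * 1 * ?p"
    by (intro mult_right_mono mult_left_mono) auto
  finally show ?thesis by simp
qed

text \<open>
  Hitting a closed set during a time interval is an event of the past, up to a null set. \<open>Bn n\<close> is the
  event that a dyadic time of the interval finds the process in the neighbourhood \<open>U n\<close> of \<open>K\<close>, \<open>\<sigma>n n\<close> is the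
  first entrance time into \<open>U n\<close>, and \<open>\<sigma>\<close> is the limit of these times.
\<close>

lemma hitting_closed_set:
  assumes K: "closed K" "K \<noteq> {}" and ab: "0 \<le> a" "a < b"
  shows "\<exists>B\<in>sets (F b). AE \<omega> in M. (\<exists>u\<in>{a..b}. Z u \<omega> \<in> K) \<longleftrightarrow> \<omega> \<in> B"
proof -
  define tm where "tm l j = a + (b - a) * (real j / 2 ^ l)" for l j :: nat
  define U where "U n = {x. infdist x K < 1 / real (Suc n)}" for n
  have tm: "a \<le> tm l j" "j \<le> 2 ^ l \<Longrightarrow> tm l j \<le> b" for l j
  proof -
    show "a \<le> tm l j" using ab by (simp add: tm_def)
    assume "j \<le> 2 ^ l"
    then have "real j / 2 ^ l \<le> 1" by simp
    then have "(b - a) * (real j / 2 ^ l) \<le> (b - a) * 1" using ab by (intro mult_left_mono) auto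
    then show "tm l j \<le> b" by (simp add: tm_def)
  qed
  have tm0: "0 \<le> tm l j" for l j using tm(1)[of l j] ab by linarith
  have tm_refine: "tm l j = tm l' (j * 2 ^ (l' - l))" if "l \<le> l'" for l l' j
  proof -
    have "(2::real) ^ l' = 2 ^ l * 2 ^ (l' - l)" using that by (simp add: power_add[symmetric])
    then show ?thesis by (simp add: tm_def)
  qed
  have tm_mono: "tm l i \<le> tm l j" if "i \<le> j" for l i j
    using that ab by (auto simp: tm_def intro!: mult_left_mono divide_right_mono)
  have U_open: "open (U n)" for n
    unfolding U_def by (intro open_Collect_less continuous_intros)
  have U_sets [measurable]: "U n \<in> sets borel" for n using U_open by auto
  have U_anti: "U m \<subseteq> U n" if "n \<le> m" for m n
  proof -
    have "1 / real (Suc m) \<le> 1 / real (Suc n)" using that by (simp add: frac_le)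
    then show ?thesis unfolding U_def by auto
  qed
  have Z_F: "Z (tm l j) \<in> borel_measurable (F b)" if "j \<le> 2 ^ l" for l j
    using adapted_mono[OF tm0 tm(2)[OF that]] .
  have Z_M [measurable]: "Z (tm l j) \<in> borel_measurable M" for l j using tm0 by auto
  have b0: "0 \<le> b" using ab by simp
  define Bn where "Bn n = (\<Union>l. \<Union>j\<in>{..2 ^ l}. Z (tm l j) -` U n \<inter> space M)" for n
  define B where "B = (\<Inter>n. Bn n)"
  have "Z (tm l j) -` U n \<inter> space M \<in> sets (F b)" if "j \<le> 2 ^ l" for l j n
    using measurable_sets[OF Z_F[OF that] U_sets[of n]] b0 by simp
  then have "Bn n \<in> sets (F b)" for n
    unfolding Bn_def by (intro sets.countable_UN image_subsetI sets.finite_UN) auto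
  then have B_F: "B \<in> sets (F b)" unfolding B_def by auto
  then have BM [measurable]: "B \<in> sets M" using sets_F_subset b0 by blast

  have to: "\<omega> \<in> B" if \<omega>: "\<omega> \<in> space M" and u: "u \<in> {a..b}" "Z u \<omega> \<in> K" for \<omega> u
  proof -
    have "\<exists>l. \<exists>j\<le>2 ^ l. Z (tm l j) \<omega> \<in> U n" for n
    proof (cases "u = b")
      case True
      have "Z (tm 0 1) \<omega> \<in> U n" using u True by (simp add: tm_def U_def)
      then show ?thesis by (intro exI[of _ 0] exI[of _ 1]) auto
    next
      case False
      define v where "v = (u - a) / (b - a)"
      have v: "0 \<le> v" "v < 1" "u = a + (b - a) * v" using u False ab by (auto simp: v_def field_simps)
      have "(\<lambda>l. Z (tm l (dyadic_above l v)) \<omega>) \<longlonglongrightarrow> Z u \<omega>"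
        unfolding v(3) tm_def by (rule tendsto_dyadic) (use \<omega> v ab in auto)
      moreover have "Z u \<omega> \<in> U n" using u by (simp add: U_def)
      ultimately have "eventually (\<lambda>l. Z (tm l (dyadic_above l v)) \<omega> \<in> U n) sequentially"
        using topological_tendstoD[OF _ U_open] by blast
      then obtain l where "Z (tm l (dyadic_above l v)) \<omega> \<in> U n"
        by (auto dest: eventually_happens)
      moreover have "dyadic_above l v \<le> 2 ^ l" using v by (simp add: dyadic_above_le_iff)
      ultimately show ?thesis by blast
    qed
    then show ?thesis unfolding B_def Bn_def using \<omega> by (auto simp: Bex_def)
  qed

  \<comment> \<open>adding \<open>b\<close> makes the infimum a measurable function everywhere, without changing it on \<open>B\<close>\<close>
  define S where "S n \<omega> = insert b {tm l j | l j. j \<le> 2 ^ l \<and> Z (tm l j) \<omega> \<in> U n}" for n \<omega>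
  define \<sigma>n where "\<sigma>n n \<omega> = Inf (S n \<omega>)" for n \<omega>
  define \<sigma> where "\<sigma> \<omega> = (SUP n. \<sigma>n n \<omega>)" for \<omega>
  have S_ge: "a \<le> x" if "x \<in> S n \<omega>" for x n \<omega>
    using that tm(1) ab by (auto simp: S_def)
  have S_bdd: "bdd_below (S n \<omega>)" for n \<omega> using S_ge by (rule bdd_belowI)
  have S_ne: "S n \<omega> \<noteq> {}" for n \<omega> by (simp add: S_def)
  have \<sigma>n_bounds: "a \<le> \<sigma>n n \<omega>" "\<sigma>n n \<omega> \<le> b" for n \<omega>
  proof -
    show "a \<le> \<sigma>n n \<omega>" unfolding \<sigma>n_def by (rule cInf_greatest[OF S_ne S_ge])
    show "\<sigma>n n \<omega> \<le> b" unfolding \<sigma>n_def by (rule cInf_lower[OF _ S_bdd]) (simp add: S_def)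
  qed
  have \<sigma>n_mono: "\<sigma>n n \<omega> \<le> \<sigma>n m \<omega>" if "n \<le> m" for n m \<omega>
    unfolding \<sigma>n_def by (rule cInf_superset_mono[OF S_ne S_bdd]) (use U_anti[OF that] in \<open>auto simp: S_def\<close>)
  have \<sigma>_bdd: "bdd_above (range (\<lambda>n. \<sigma>n n \<omega>))" for \<omega>
    using \<sigma>n_bounds(2) by (intro bdd_aboveI[of _ b]) auto
  have \<sigma>_ge: "\<sigma>n n \<omega> \<le> \<sigma> \<omega>" for n \<omega>
    unfolding \<sigma>_def by (rule cSUP_upper[OF _ \<sigma>_bdd]) simp
  have \<sigma>_bounds: "a \<le> \<sigma> \<omega>" "\<sigma> \<omega> \<le> b" for \<omega>
    using \<sigma>_ge[of 0 \<omega>] \<sigma>n_bounds(1)[of 0 \<omega>] \<sigma>n_bounds(2)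
    by (auto simp: \<sigma>_def intro!: cSUP_least)
  have \<sigma>n_meas [measurable]: "\<sigma>n n \<in> borel_measurable M" for n
  proof (subst borel_measurable_iff_less, rule allI)
    fix x
    have "{\<omega>\<in>space M. \<sigma>n n \<omega> < x} =
      {\<omega>\<in>space M. b < x \<or> (\<exists>l. \<exists>j\<in>{..2 ^ l}. tm l j < x \<and> Z (tm l j) \<omega> \<in> U n)}"
      unfolding \<sigma>n_def cInf_less_iff[OF S_ne S_bdd] by (auto simp: S_def)
    also have "\<dots> \<in> sets M" by measurable
    finally show "{\<omega>\<in>space M. \<sigma>n n \<omega> < x} \<in> sets M" .
  qed
  have [measurable]: "\<sigma> \<in> borel_measurable M"
    unfolding \<sigma>_def by (rule borel_measurable_cSUP) (use \<sigma>_bdd in auto)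

  \<comment> \<open>right continuity: the neighbourhood is reached, up to closure, at the infimum\<close>
  have at_\<sigma>n: "infdist (Z (\<sigma>n n \<omega>) \<omega>) K \<le> 1 / real (Suc n)" if \<omega>: "\<omega> \<in> B" for n \<omega>
  proof (rule ccontr)
    assume *: "\<not> ?thesis"
    have \<omega>M: "\<omega> \<in> space M" using \<omega> BM sets.sets_into_space by blast
    have "((\<lambda>u. infdist (Z u \<omega>) K) \<longlongrightarrow> infdist (Z (\<sigma>n n \<omega>) \<omega>) K) (at_right (\<sigma>n n \<omega>))"
      by (intro tendsto_infdist right_cont \<omega>M) (use \<sigma>n_bounds(1)[of n \<omega>] ab in linarith)
    from order_tendstoD(1)[OF this, of "1 / real (Suc n)"] *
    have "eventually (\<lambda>u. 1 / real (Suc n) < infdist (Z u \<omega>) K) (at_right (\<sigma>n n \<omega>))" by simp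
    then obtain c where c: "c > \<sigma>n n \<omega>"
      "\<And>u. \<sigma>n n \<omega> < u \<Longrightarrow> u < c \<Longrightarrow> 1 / real (Suc n) < infdist (Z u \<omega>) K"
      using eventually_at_right[of "\<sigma>n n \<omega>" "\<sigma>n n \<omega> + 1"] by auto
    then obtain x where x: "x \<in> S n \<omega>" "x < c"
      unfolding \<sigma>n_def using cInf_less_iff[OF S_ne S_bdd] by blast
    have "\<exists>y\<in>S n \<omega>. y \<le> x \<and> Z y \<omega> \<in> U n"
    proof (cases "x = b")
      case True
      from \<omega> obtain l j where "j \<le> 2 ^ l" "Z (tm l j) \<omega> \<in> U n"
        by (fastforce simp: B_def Bn_def)
      then show ?thesis using tm(2) True by (intro bexI[of _ "tm l j"]) (auto simp: S_def)
    next
      case False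
      then show ?thesis using x by (intro bexI[of _ x]) (auto simp: S_def)
    qed
    then obtain y where y: "y \<in> S n \<omega>" "y \<le> x" "Z y \<omega> \<in> U n" by blast
    have "\<sigma>n n \<omega> \<le> y" unfolding \<sigma>n_def by (rule cInf_lower[OF y(1) S_bdd])
    then show False using c(2)[of y] y x * by (cases "y = \<sigma>n n \<omega>") (auto simp: U_def)
  qed

  \<comment> \<open>If \<open>Z \<sigma>\<close> has distance more than \<open>\<epsilon>\<close> from \<open>K\<close>, then either \<open>\<sigma>\<close> is still far from \<open>\<sigma>n n\<close> (the event \<open>E n\<close>), or for all fine
    grids the process oscillates by more than \<open>\<epsilon> / 2\<close> just after the first grid time at which it is in \<open>U n\<close>
    (the event \<open>V l\<close>); such a grid time precedes \<open>\<sigma>\<close>, since \<open>\<sigma>n n < \<sigma>\<close>.\<close>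
  have bad: "AE \<omega> in M. \<not> (\<omega> \<in> B \<and> infdist (Z (\<sigma> \<omega>) \<omega>) K > \<epsilon>)" if \<epsilon>: "0 < \<epsilon>" for \<epsilon>
  proof (rule AE_not_if_small_cover)
    fix e :: real assume e: "0 < e"
    obtain d where d: "d > 0" and
      small: "\<And>v. 0 \<le> v \<Longrightarrow> v \<le> d \<Longrightarrow> prob {\<omega>\<in>space M. norm (Z v \<omega>) > \<epsilon> / 4} \<le> min (1 / 2) (e / 4)"
      using stochastic_continuity[of "\<epsilon> / 4" "min (1 / 2) (e / 4)"] \<epsilon> e by auto
    define E where "E n = {\<omega>\<in>space M. \<sigma> \<omega> - \<sigma>n n \<omega> \<ge> d}" for n
    have EM [measurable]: "E n \<in> sets M" for n unfolding E_def by measurable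
    have "decseq E" unfolding E_def decseq_def using \<sigma>n_mono by (auto, smt (verit))
    then have "(\<lambda>n. prob (E n)) \<longlonglongrightarrow> prob (\<Inter>n. E n)"
      by (intro finite_Lim_measure_decseq) auto
    moreover have "(\<Inter>n. E n) = {}"
    proof -
      have "\<exists>n. \<omega> \<notin> E n" for \<omega>
      proof -
        obtain n where "\<sigma> \<omega> - d < \<sigma>n n \<omega>"
          using less_cSUP_iff[OF UNIV_not_empty \<sigma>_bdd, of "\<sigma> \<omega> - d" \<omega>] d
          unfolding \<sigma>_def[of \<omega>, symmetric] by auto
        then show ?thesis by (auto simp: E_def intro!: exI[of _ n])
      qed
      then show ?thesis by blast
    qed
    ultimately have "(\<lambda>n. prob (E n)) \<longlonglongrightarrow> 0" by simp
    then have "eventually (\<lambda>n. prob (E n) < e / 2) sequentially"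
      using e by (intro order_tendstoD) auto
    moreover have "eventually (\<lambda>n. 1 / real (Suc n) < \<epsilon> / 2) sequentially"
      using order_tendstoD(2)[OF LIMSEQ_inverse_real_of_nat, of "\<epsilon> / 2"] \<epsilon>
      by (simp add: inverse_eq_divide)
    ultimately have "eventually (\<lambda>n. prob (E n) < e / 2 \<and> 1 / real (Suc n) < \<epsilon> / 2) sequentially"
      by eventually_elim simp
    then obtain n where n: "prob (E n) < e / 2" "1 / real (Suc n) < \<epsilon> / 2"
      by (auto dest: eventually_happens)
    define H where "H l j = {\<omega>\<in>space M. Z (tm l j) \<omega> \<in> U n \<and> (\<forall>i\<in>{..<j}. Z (tm l i) \<omega> \<notin> U n)}" for l j
    define V where "V l = (\<Union>j\<in>{..2 ^ l}. H l j \<inter> osc (tm l j) d (\<epsilon> / 4 + \<epsilon> / 4))" for l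
    have H_F: "H l j \<in> sets (F (tm l j))" for l j
    proof -
      have *: "{\<omega>\<in>space (F (tm l j)). Z (tm l i) \<omega> \<in> U n} \<in> sets (F (tm l j))" if "i \<le> j" for i
        using measurable_sets[OF adapted_mono[OF tm0 tm_mono[OF that]] U_sets[of n]]
        by (simp add: vimage_def Int_def conj_commute)
      have "{\<omega>\<in>space (F (tm l j)). Z (tm l j) \<omega> \<in> U n \<and> (\<forall>i\<in>{..<j}. Z (tm l i) \<omega> \<notin> U n)}
          \<in> sets (F (tm l j))"
        by (intro sets.sets_Collect_conj sets.sets_Collect_finite_All sets.sets_Collect_neg *) auto
      then show ?thesis unfolding H_def space_F[OF tm0] .
    qed
    have H_disj: "disjoint_family_on (H l) J" for l J
    proof -
      have "H l i \<inter> H l j = {}" if "i < j" for i j using that by (auto simp: H_def)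
      then show ?thesis unfolding disjoint_family_on_def by (metis inf_commute linorder_neqE_nat)
    qed
    have HM [measurable]: "H l j \<in> sets M" for l j using H_F tm0 sets_F_subset by blast
    have VM [measurable]: "V l \<in> sets M" for l
      unfolding V_def using osc_sets[OF tm0, of d] d by auto
    have V_le: "prob (V l) \<le> e / 2" for l
    proof -
      have "prob (V l) \<le> 2 * prob {\<omega>\<in>space M. norm (Z d \<omega>) > \<epsilon> / 4}"
        unfolding V_def
        by (rule prob_osc_after_simple_time) (use H_disj tm0 H_F d small in auto)
      then show ?thesis using small[of d] d by auto
    qed
    define N where "N = E n \<union> (\<Union>m. \<Inter>l\<in>{m..}. V l)"
    have NM: "N \<in> sets M" unfolding N_def by measurable
    have liminf: "prob (\<Union>m. \<Inter>l\<in>{m..}. V l) \<le> e / 2"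
    proof (rule LIMSEQ_le_const2)
      show "(\<lambda>m. prob (\<Inter>l\<in>{m..}. V l)) \<longlonglongrightarrow> prob (\<Union>m. \<Inter>l\<in>{m..}. V l)"
        by (rule finite_Lim_measure_incseq) (auto simp: incseq_def)
      have "prob (\<Inter>l\<in>{m..}. V l) \<le> e / 2" for m
        by (rule order_trans[OF finite_measure_mono V_le[of m]]) auto
      then show "\<exists>N. \<forall>m\<ge>N. prob (\<Inter>l\<in>{m..}. V l) \<le> e / 2" by blast
    qed
    have "prob N \<le> prob (E n) + prob (\<Union>m. \<Inter>l\<in>{m..}. V l)"
      unfolding N_def by (rule measure_Un_le) auto
    then have "prob N \<le> e" using n(1) liminf by simp
    then have N_le: "emeasure M N \<le> ennreal e"
      by (simp add: emeasure_eq_measure ennreal_leI)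
    have "\<omega> \<in> N" if \<omega>: "\<omega> \<in> space M" "\<omega> \<in> B" "infdist (Z (\<sigma> \<omega>) \<omega>) K > \<epsilon>" for \<omega>
    proof (rule ccontr)
      assume nN: "\<omega> \<notin> N"
      then have d': "\<sigma> \<omega> - \<sigma>n n \<omega> < d" using \<omega>(1) by (auto simp: N_def E_def)
      have "\<sigma>n n \<omega> \<noteq> \<sigma> \<omega>" using at_\<sigma>n[OF \<omega>(2), of n] \<omega>(3) n(2) \<epsilon> by auto
      then have "\<sigma>n n \<omega> < \<sigma> \<omega>" using \<sigma>_ge[of n \<omega>] by simp
      then obtain x where x: "x \<in> S n \<omega>" "x < \<sigma> \<omega>"
        unfolding \<sigma>n_def using cInf_less_iff[OF S_ne S_bdd] by blast
      then obtain m i where i: "i \<le> 2 ^ m" "Z (tm m i) \<omega> \<in> U n" "x = tm m i"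
        using \<sigma>_bounds(2)[of \<omega>] by (auto simp: S_def)
      have "\<omega> \<in> V l" if l: "m \<le> l" for l
      proof -
        define P where "P j \<longleftrightarrow> Z (tm l j) \<omega> \<in> U n" for j
        define j where "j = (LEAST j. P j)"
        have Pi: "P (i * 2 ^ (l - m))" using i tm_refine[OF l, of i] by (simp add: P_def)
        then have Pj: "P j" and j_le: "j \<le> i * 2 ^ (l - m)"
          unfolding j_def by (auto intro: LeastI Least_le)
        have "i * 2 ^ (l - m) \<le> 2 ^ m * 2 ^ (l - m)" using i by simp
        also have "\<dots> = 2 ^ l" using l by (simp add: power_add[symmetric])
        finally have jl: "j \<le> 2 ^ l" using j_le by simp
        have "\<not> P k" if "k < j" for k using that unfolding j_def by (rule not_less_Least)
        then have "\<omega> \<in> H l j" using Pj \<omega> by (auto simp: H_def P_def)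
        moreover have "\<omega> \<in> osc (tm l j) d (\<epsilon> / 4 + \<epsilon> / 4)"
        proof (rule ccontr)
          assume no: "\<not> ?thesis"
          have "tm l j \<le> x" using tm_mono[OF j_le, of l] tm_refine[OF l, of i] i(3) by simp
          then have le: "tm l j \<le> \<sigma> \<omega>" using x by simp
          have "tm l j \<in> S n \<omega>" using jl Pj by (auto simp: S_def P_def)
          then have "\<sigma>n n \<omega> \<le> tm l j" unfolding \<sigma>n_def by (rule cInf_lower[OF _ S_bdd])
          then have "\<sigma> \<omega> \<le> tm l j + d" using d' by simp
          from norm_le_if_not_osc[OF \<omega>(1) tm0 d no le this]
          have "dist (Z (\<sigma> \<omega>) \<omega>) (Z (tm l j) \<omega>) \<le> \<epsilon> / 2" by (simp add: dist_norm)
          moreover have "infdist (Z (tm l j) \<omega>) K < \<epsilon> / 2" using Pj n(2) by (simp add: P_def U_def)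
          ultimately show False
            using infdist_triangle[of "Z (\<sigma> \<omega>) \<omega>" K "Z (tm l j) \<omega>"] \<omega>(3) by simp
        qed
        ultimately show ?thesis using jl by (auto simp: V_def)
      qed
      then show False using nN by (auto simp: N_def)
    qed
    then show "\<exists>N\<in>sets M. emeasure M N \<le> ennreal e \<and>
        (\<forall>\<omega>\<in>space M. \<omega> \<in> B \<and> infdist (Z (\<sigma> \<omega>) \<omega>) K > \<epsilon> \<longrightarrow> \<omega> \<in> N)"
      using NM N_le by blast
  qed
  have "AE \<omega> in M. \<forall>n. \<not> (\<omega> \<in> B \<and> infdist (Z (\<sigma> \<omega>) \<omega>) K > 1 / real (Suc n))"
    unfolding AE_all_countable by (intro allI bad) simp
  with AE_space have "AE \<omega> in M. (\<exists>u\<in>{a..b}. Z u \<omega> \<in> K) \<longleftrightarrow> \<omega> \<in> B"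
  proof (eventually_elim, intro iffI)
    fix \<omega> assume "\<omega> \<in> space M" "\<exists>u\<in>{a..b}. Z u \<omega> \<in> K"
    then show "\<omega> \<in> B" using to by blast
  next
    fix \<omega> assume \<omega>: "\<forall>n. \<not> (\<omega> \<in> B \<and> infdist (Z (\<sigma> \<omega>) \<omega>) K > 1 / real (Suc n))" "\<omega> \<in> B"
    have "infdist (Z (\<sigma> \<omega>) \<omega>) K \<le> 0"
      by (rule LIMSEQ_le_const[OF LIMSEQ_inverse_real_of_nat])
        (use \<omega> in \<open>auto simp: inverse_eq_divide not_less\<close>)
    then have "Z (\<sigma> \<omega>) \<omega> \<in> K"
      using in_closed_iff_infdist_zero[OF K] infdist_nonneg[of "Z (\<sigma> \<omega>) \<omega>" K] by simp
    then show "\<exists>u\<in>{a..b}. Z u \<omega> \<in> K" using \<sigma>_bounds[of \<omega>] by auto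
  qed
  then show ?thesis using B_F by blast
qed

text \<open>The open time interval from 0 to \<open>t\<close> is exhausted by the compact intervals \<open>[a m, t - a m]\<close>.\<close>

lemma exit_time_optional:
  assumes D: "open D" "D \<noteq> UNIV" and t: "0 < t"
  shows "\<exists>B\<in>sets (F t). AE \<omega> in M. exit_time Z D \<omega> < ennreal t \<longleftrightarrow> \<omega> \<in> B"
proof -
  define a where "a m = t / real (m + 3)" for m :: nat
  have a: "0 < a m" "a m < t - a m" for m
  proof -
    have "a m \<le> t / 3" unfolding a_def using t by (intro divide_left_mono) auto
    then show "0 < a m" "a m < t - a m" using t by (auto simp: a_def)
  qed
  have "\<exists>B\<in>sets (F (t - a m)). AE \<omega> in M. (\<exists>u\<in>{a m..t - a m}. Z u \<omega> \<in> - D) \<longleftrightarrow> \<omega> \<in> B" for m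
    by (rule hitting_closed_set) (use D a[of m] in auto)
  then have "\<forall>m. \<exists>B. B \<in> sets (F (t - a m)) \<and>
      (AE \<omega> in M. (\<exists>u\<in>{a m..t - a m}. Z u \<omega> \<in> - D) \<longleftrightarrow> \<omega> \<in> B)" by blast
  from choice[OF this] obtain B where B: "\<And>m. B m \<in> sets (F (t - a m))"
    "\<And>m. AE \<omega> in M. (\<exists>u\<in>{a m..t - a m}. Z u \<omega> \<in> - D) \<longleftrightarrow> \<omega> \<in> B m"
    by blast
  have "B m \<in> sets (F t)" for m
    using B(1)[of m] F_mono[of "t - a m" t] a[of m] by auto
  then have "(\<Union>m. B m) \<in> sets (F t)" by auto
  moreover have "AE \<omega> in M. \<forall>m. (\<exists>u\<in>{a m..t - a m}. Z u \<omega> \<in> - D) \<longleftrightarrow> \<omega> \<in> B m"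
    unfolding AE_all_countable using B(2) by blast
  then have "AE \<omega> in M. exit_time Z D \<omega> < ennreal t \<longleftrightarrow> \<omega> \<in> (\<Union>m. B m)"
  proof eventually_elim
    fix \<omega> assume *: "\<forall>m. (\<exists>u\<in>{a m..t - a m}. Z u \<omega> \<in> - D) \<longleftrightarrow> \<omega> \<in> B m"
    have "exit_time Z D \<omega> < ennreal t \<longleftrightarrow> (\<exists>u. 0 < u \<and> u < t \<and> Z u \<omega> \<in> - D)"
      unfolding exit_time_def INF_less_iff by (auto simp: ennreal_less_iff)
    also have "\<dots> \<longleftrightarrow> (\<exists>m. \<exists>u\<in>{a m..t - a m}. Z u \<omega> \<in> - D)"
    proof
      assume "\<exists>u. 0 < u \<and> u < t \<and> Z u \<omega> \<in> - D"
      then obtain u where u: "0 < u" "u < t" "Z u \<omega> \<in> - D" by blast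
      have "(\<lambda>m. t * inverse (real (Suc (m + 2)))) \<longlonglongrightarrow> t * 0"
        by (intro tendsto_mult tendsto_const LIMSEQ_ignore_initial_segment[OF LIMSEQ_inverse_real_of_nat])
      moreover have "t * inverse (real (Suc (m + 2))) = a m" for m
        by (simp add: a_def divide_inverse)
      ultimately have "a \<longlonglongrightarrow> 0" by simp
      from order_tendstoD(2)[OF this, of "min u (t - u)"] u
      have "eventually (\<lambda>m. a m < min u (t - u)) sequentially" by simp
      then obtain m where "a m < min u (t - u)" by (auto dest: eventually_happens)
      then show "\<exists>m. \<exists>u\<in>{a m..t - a m}. Z u \<omega> \<in> - D"
        using u by (intro exI[of _ m] bexI[of _ u]) auto
    next
      assume "\<exists>m. \<exists>u\<in>{a m..t - a m}. Z u \<omega> \<in> - D"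
      then obtain m u where "u \<in> {a m..t - a m}" "Z u \<omega> \<in> - D" by blast
      then show "\<exists>u. 0 < u \<and> u < t \<and> Z u \<omega> \<in> - D" using a[of m] by (intro exI[of _ u]) auto
    qed
    finally show "exit_time Z D \<omega> < ennreal t \<longleftrightarrow> \<omega> \<in> (\<Union>m. B m)" using * by blast
  qed
  ultimately show ?thesis by blast
qed

end

section \<open>Weighted sums of increments along dyadic grids\<close>

lemma suminf_indicator_le:
  assumes "0 \<le> x"
  shows "(\<Sum>i. (if real i \<le> x then 1 else 0 :: ennreal)) \<le> ennreal (x + 1)"
proof -
  have "(\<Sum>i. (if real i \<le> x then 1 else 0 :: ennreal)) = (\<Sum>i\<le>nat \<lfloor>x\<rfloor>. if real i \<le> x then 1 else 0)"
  proof (rule suminf_finite)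
    fix i assume "i \<notin> {..nat \<lfloor>x\<rfloor>}"
    then have "\<not> real i \<le> x" using le_nat_floor[of i x] by auto
    then show "(if real i \<le> x then 1 else 0 :: ennreal) = 0" by simp
  qed simp
  also have "\<dots> \<le> (\<Sum>i\<le>nat \<lfloor>x\<rfloor>. 1)" by (intro sum_mono) auto
  also have "\<dots> = ennreal (real (nat \<lfloor>x\<rfloor> + 1))"
    by (simp only: sum_constant card_atMost) (simp add: ennreal_of_nat_eq_real_of_nat)
  also have "\<dots> \<le> ennreal (x + 1)" using assms by (intro ennreal_leI) (simp add: of_nat_floor)
  finally show ?thesis .
qed

lemma sum_stopped_increments:
  fixes f :: "nat \<Rightarrow> 'b::real_vector"
  assumes "r \<le> n"
  shows "(\<Sum>j<n. (of_bool (j < r) :: real) *\<^sub>R (f (Suc j) - f j)) = f r - f 0"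
proof -
  have "(\<Sum>j<n. (of_bool (j < r) :: real) *\<^sub>R (f (Suc j) - f j)) = (\<Sum>j<r. f (Suc j) - f j)"
    using assms by (intro sum.mono_neutral_cong_right) auto
  then show ?thesis by (simp add: sum_lessThan_telescope)
qed

lemma sum_square_of_bool_diff:
  assumes "r \<le> n" "r' \<le> n"
  shows "(\<Sum>j<n. (of_bool (j < r) - of_bool (j < r') :: real)\<^sup>2) = \<bar>real r - real r'\<bar>"
proof -
  have *: "(\<Sum>j<n. (of_bool (j < r) - of_bool (j < r') :: real)\<^sup>2) = real r' - real r"
    if "r \<le> r'" "r' \<le> n" for r r'
  proof -
    have "(\<Sum>j<n. (of_bool (j < r) - of_bool (j < r') :: real)\<^sup>2) = (\<Sum>j\<in>{r..<r'}. 1)"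
      using that by (intro sum.mono_neutral_cong_right) auto
    then show ?thesis using that by simp
  qed
  show ?thesis
  proof (cases "r \<le> r'")
    case True then show ?thesis using *[of r r'] assms by simp
  next
    case False
    then show ?thesis using *[of r' r] assms by (simp add: power2_commute)
  qed
qed

text \<open>
  The cap at time \<open>k\<close> leaves only finitely many values. It is eventually inactive, but it may put the
  approximation to the left of \<open>u\<close> for small \<open>k\<close>.
\<close>

definition dyadic_time :: "nat \<Rightarrow> real \<Rightarrow> nat" where
  "dyadic_time k u = min (dyadic_above k u) (k * 2 ^ k)"

lemma dyadic_time_eventually:
  assumes "0 \<le> u"
  shows "eventually (\<lambda>k. dyadic_time k u = dyadic_above k u) sequentially"
proof -
  have "eventually (\<lambda>k. u + 1 \<le> real k) sequentially"
    using eventually_ge_at_top[of "nat \<lceil>u + 1\<rceil>"] by eventually_elim linarith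
  then show ?thesis
  proof eventually_elim
    case (elim k)
    have "u < real (k * 2 ^ k) / 2 ^ k" using elim by simp
    then have "dyadic_above k u \<le> k * 2 ^ k" using dyadic_above_le_iff[OF assms] by blast
    then show ?case by (simp add: dyadic_time_def)
  qed
qed

lemma dyadic_time_tendsto:
  assumes "0 \<le> u"
  shows "filterlim (\<lambda>k. real (dyadic_time k u) / 2 ^ k) (at_right u) sequentially"
proof -
  have "eventually (\<lambda>k. real (dyadic_above k u) / 2 ^ k = real (dyadic_time k u) / 2 ^ k) sequentially"
    using dyadic_time_eventually[OF assms] by eventually_elim simp
  from filterlim_cong[OF refl refl this] dyadic_above_tendsto[OF assms] show ?thesis by blast
qed

lemma dyadic_time_le:
  assumes "0 \<le> u"
  shows "real (dyadic_time k u) / 2 ^ k \<le> real (nat \<lfloor>u\<rfloor> + 1)"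
proof -
  have "u < real (nat \<lfloor>u\<rfloor> + 1)" by linarith
  then have "u < real ((nat \<lfloor>u\<rfloor> + 1) * 2 ^ k) / 2 ^ k" by (simp only: of_nat_mult of_nat_power) simp
  then have "dyadic_above k u \<le> (nat \<lfloor>u\<rfloor> + 1) * 2 ^ k"
    using dyadic_above_le_iff[OF assms] by blast
  then have "dyadic_time k u \<le> (nat \<lfloor>u\<rfloor> + 1) * 2 ^ k" by (simp add: dyadic_time_def)
  then have "real (dyadic_time k u) \<le> real ((nat \<lfloor>u\<rfloor> + 1) * 2 ^ k)" by (rule of_nat_mono)
  then show ?thesis by (simp add: field_simps)
qed

text \<open>The dyadic time of level \<open>k\<close>, read on the finer grid of level \<open>l\<close>.\<close>

lemma dyadic_time_refine_less_iff:
  assumes "0 \<le> u" "k \<le> l"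
  shows "j < dyadic_time k u * 2 ^ (l - k) \<longleftrightarrow>
    j < k * 2 ^ l \<and> \<not> u < real (j div 2 ^ (l - k)) / 2 ^ k"
proof -
  have *: "j < r * 2 ^ (l - k) \<longleftrightarrow> j div 2 ^ (l - k) < r" for r
    by (simp add: div_less_iff_less_mult)
  have "(2::nat) ^ l = 2 ^ k * 2 ^ (l - k)" using assms(2) by (simp add: power_add[symmetric])
  then have "j < k * 2 ^ l \<longleftrightarrow> j div 2 ^ (l - k) < k * 2 ^ k"
    using *[of "k * 2 ^ k"] by (simp add: mult.assoc)
  then show ?thesis
    unfolding * dyadic_time_def using dyadic_above_le_iff[OF assms(1), of k "j div 2 ^ (l - k)"]
    by (auto simp: not_less[symmetric])
qed

context adapted_increments
begin

lemma indep_var_increment: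
  assumes s: "0 \<le> s" "s \<le> t" and U: "U \<in> borel_measurable (F s)"
  shows "indep_var borel U borel (\<lambda>\<omega>. Z t \<omega> - Z s \<omega>)"
proof -
  let ?V = "\<lambda>\<omega>. Z t \<omega> - Z s \<omega>"
  have UM [measurable]: "U \<in> borel_measurable M" using measurable_F_M[OF s(1) U] .
  have [measurable]: "Z t \<in> borel_measurable M" "Z s \<in> borel_measurable M" using s by auto
  have st: "Int_stable {f -` A \<inter> space M |A. A \<in> sets borel}" for f :: "'w \<Rightarrow> 'c::topological_space"
    unfolding Int_stable_def
  proof safe
    fix A A' :: "'c set" assume "A \<in> sets borel" "A' \<in> sets borel"
    then show "\<exists>B. (f -` A \<inter> space M) \<inter> (f -` A' \<inter> space M) = f -` B \<inter> space M \<and> B \<in> sets borel"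
      by (intro exI[of _ "A \<inter> A'"]) auto
  qed
  have "indep_set {U -` A \<inter> space M |A. A \<in> sets borel} {?V -` A \<inter> space M |A. A \<in> sets borel}"
  proof (rule indep_setI)
    show "{U -` A \<inter> space M |A. A \<in> sets borel} \<subseteq> events" "{?V -` A \<inter> space M |A. A \<in> sets borel} \<subseteq> events"
      by (auto intro: measurable_sets)
    fix a b assume "a \<in> {U -` A \<inter> space M |A. A \<in> sets borel}" "b \<in> {?V -` A \<inter> space M |A. A \<in> sets borel}"
    then obtain A B where AB: "a = U -` A \<inter> space M" "A \<in> sets borel" "b = ?V -` B \<inter> space M" "B \<in> sets borel"
      by blast
    have "a \<in> sets (F s)" using measurable_sets[OF U AB(2)] s by (simp add: AB(1))
    moreover have "b = {\<omega>\<in>space M. ?V \<omega> \<in> B}" using AB(3) by auto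
    ultimately show "prob (a \<inter> b) = prob a * prob b" using indep_past[OF s _ AB(4)] by simp
  qed
  then have "indep_set (sigma_sets (space M) {U -` A \<inter> space M |A. A \<in> sets borel})
      (sigma_sets (space M) {?V -` A \<inter> space M |A. A \<in> sets borel})"
    by (rule indep_set_sigma_sets) (rule st)+
  then show ?thesis unfolding indep_var_eq by simp
qed

lemma integral_increment:
  fixes f :: "'a \<Rightarrow> 'b::{banach, second_countable_topology}"
  assumes "0 \<le> s" "s \<le> t" and [measurable]: "f \<in> borel_measurable borel"
  shows "(\<integral>\<omega>. f (Z t \<omega> - Z s \<omega>) \<partial>M) = (\<integral>\<omega>. f (Z (t - s) \<omega>) \<partial>M)"
    and "integrable M (\<lambda>\<omega>. f (Z t \<omega> - Z s \<omega>)) \<longleftrightarrow> integrable M (\<lambda>\<omega>. f (Z (t - s) \<omega>))"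
proof -
  have [measurable]: "(\<lambda>\<omega>. Z t \<omega> - Z s \<omega>) \<in> borel_measurable M" "Z (t - s) \<in> borel_measurable M"
    using assms by auto
  have "(\<integral>\<omega>. f (Z t \<omega> - Z s \<omega>) \<partial>M) = integral\<^sup>L (distr M borel (\<lambda>\<omega>. Z t \<omega> - Z s \<omega>)) f"
    by (subst integral_distr) auto
  also have "\<dots> = integral\<^sup>L (distr M borel (Z (t - s))) f" using distr_increment assms by simp
  also have "\<dots> = (\<integral>\<omega>. f (Z (t - s) \<omega>) \<partial>M)"
    by (subst integral_distr) auto
  finally show "(\<integral>\<omega>. f (Z t \<omega> - Z s \<omega>) \<partial>M) = (\<integral>\<omega>. f (Z (t - s) \<omega>) \<partial>M)" .
  have "integrable M (\<lambda>\<omega>. f (Z t \<omega> - Z s \<omega>)) \<longleftrightarrow> integrable (distr M borel (\<lambda>\<omega>. Z t \<omega> - Z s \<omega>)) f"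
    by (subst integrable_distr_eq) auto
  also have "\<dots> \<longleftrightarrow> integrable (distr M borel (Z (t - s))) f" using distr_increment assms by simp
  also have "\<dots> \<longleftrightarrow> integrable M (\<lambda>\<omega>. f (Z (t - s) \<omega>))"
    by (subst integrable_distr_eq) auto
  finally show "integrable M (\<lambda>\<omega>. f (Z t \<omega> - Z s \<omega>)) \<longleftrightarrow> integrable M (\<lambda>\<omega>. f (Z (t - s) \<omega>))" .
qed

lemma inner_increment:
  assumes s: "0 \<le> s" "s \<le> t" and U: "U \<in> borel_measurable (F s)" "integrable M U"
    and Z: "\<And>t. 0 \<le> t \<Longrightarrow> integrable M (Z t)" "\<And>t. 0 \<le> t \<Longrightarrow> (\<integral>\<omega>. Z t \<omega> \<partial>M) = 0"
  shows "integrable M (\<lambda>\<omega>. U \<omega> \<bullet> (Z t \<omega> - Z s \<omega>))"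
    and "(\<integral>\<omega>. U \<omega> \<bullet> (Z t \<omega> - Z s \<omega>) \<partial>M) = 0"
proof -
  let ?V = "\<lambda>\<omega>. Z t \<omega> - Z s \<omega>"
  have Vi: "integrable M ?V" and V0: "(\<integral>\<omega>. ?V \<omega> \<partial>M) = 0" using Z s by auto
  have ind: "indep_var borel (\<lambda>\<omega>. U \<omega> \<bullet> b) borel (\<lambda>\<omega>. ?V \<omega> \<bullet> b)" for b
    using indep_var_compose[OF indep_var_increment[OF s U(1)], of "\<lambda>x. x \<bullet> b" borel "\<lambda>x. x \<bullet> b" borel]
    by (simp add: comp_def)
  have i: "integrable M (\<lambda>\<omega>. U \<omega> \<bullet> b)" "integrable M (\<lambda>\<omega>. ?V \<omega> \<bullet> b)" for b
    using U Vi by auto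
  have "(\<integral>\<omega>. (U \<omega> \<bullet> b) * (?V \<omega> \<bullet> b) \<partial>M) = (\<integral>\<omega>. U \<omega> \<bullet> b \<partial>M) * (\<integral>\<omega>. ?V \<omega> \<bullet> b \<partial>M)" for b
    by (rule indep_var_lebesgue_integral[OF ind i])
  moreover have "(\<integral>\<omega>. ?V \<omega> \<bullet> b \<partial>M) = 0" for b using Vi V0 by simp
  ultimately have 0: "(\<integral>\<omega>. (U \<omega> \<bullet> b) * (?V \<omega> \<bullet> b) \<partial>M) = 0" for b by simp
  have int: "integrable M (\<lambda>\<omega>. (U \<omega> \<bullet> b) * (?V \<omega> \<bullet> b))" for b
    by (rule indep_var_integrable[OF ind i])
  have eq: "(\<lambda>\<omega>. U \<omega> \<bullet> ?V \<omega>) = (\<lambda>\<omega>. \<Sum>b\<in>Basis. (U \<omega> \<bullet> b) * (?V \<omega> \<bullet> b))"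
    by (rule ext) (rule euclidean_inner)
  show "integrable M (\<lambda>\<omega>. U \<omega> \<bullet> ?V \<omega>)" unfolding eq using int by (intro Bochner_Integration.integrable_sum)
  show "(\<integral>\<omega>. U \<omega> \<bullet> ?V \<omega> \<partial>M) = 0" unfolding eq
    by (subst Bochner_Integration.integral_sum) (use int 0 in auto)
qed

text \<open>Jensen's inequality for the martingale \<open>Z\<close>, tested against \<open>sgn (Z s)\<close>.\<close>

lemma expectation_norm_mono:
  assumes s: "0 \<le> s" "s \<le> t"
    and Z: "\<And>t. 0 \<le> t \<Longrightarrow> integrable M (Z t)" "\<And>t. 0 \<le> t \<Longrightarrow> (\<integral>\<omega>. Z t \<omega> \<partial>M) = 0"
  shows "(\<integral>\<omega>. norm (Z s \<omega>) \<partial>M) \<le> (\<integral>\<omega>. norm (Z t \<omega>) \<partial>M)"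
proof -
  have Zs: "Z s \<in> borel_measurable (F s)" using adapted s by simp
  have [measurable]: "Z t \<in> borel_measurable M" "Z s \<in> borel_measurable M" using s by auto
  have U: "(\<lambda>\<omega>. sgn (Z s \<omega>)) \<in> borel_measurable (F s)"
    unfolding sgn_div_norm using Zs by measurable
  have Ui: "integrable M (\<lambda>\<omega>. sgn (Z s \<omega>))"
    by (rule integrable_const_bound[of _ 1])
      (use measurable_F_M[OF s(1) U] in \<open>auto simp: norm_sgn\<close>)
  note * = inner_increment[OF s U Ui Z]
  have n: "sgn x \<bullet> x = norm x" for x :: 'a
    by (cases "x = 0") (simp_all add: sgn_div_norm power2_norm_eq_inner[symmetric] power2_eq_square)
  have "(\<integral>\<omega>. norm (Z s \<omega>) \<partial>M) = (\<integral>\<omega>. norm (Z s \<omega>) + sgn (Z s \<omega>) \<bullet> (Z t \<omega> - Z s \<omega>) \<partial>M)"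
    using * Z(1)[OF s(1)] by simp
  also have "\<dots> \<le> (\<integral>\<omega>. norm (Z t \<omega>) \<partial>M)"
  proof (rule integral_mono)
    fix \<omega>
    have "norm (Z s \<omega>) + sgn (Z s \<omega>) \<bullet> (Z t \<omega> - Z s \<omega>) = sgn (Z s \<omega>) \<bullet> Z t \<omega>"
      by (simp add: inner_diff_right n)
    also have "\<dots> \<le> norm (sgn (Z s \<omega>)) * norm (Z t \<omega>)" by (rule norm_cauchy_schwarz)
    also have "\<dots> \<le> norm (Z t \<omega>)" by (simp add: norm_sgn)
    finally show "norm (Z s \<omega>) + sgn (Z s \<omega>) \<bullet> (Z t \<omega> - Z s \<omega>) \<le> norm (Z t \<omega>)" .
  qed (use * Z s in auto)
  finally show ?thesis .
qed

text \<open>A finite random time such that at each time it is known whether \<open>\<tau>\<close> lies strictly in the past.\<close>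

definition optional_time :: "('w \<Rightarrow> real) \<Rightarrow> bool" where
  "optional_time \<tau> \<longleftrightarrow> \<tau> \<in> borel_measurable M \<and> (\<forall>\<omega>\<in>space M. 0 \<le> \<tau> \<omega>) \<and>
     (\<forall>t>0. {\<omega>\<in>space M. \<tau> \<omega> < t} \<in> sets (F t))"

text \<open>The random time \<open>R / 2\<^sup>l\<close> is a stopping time along the grid of mesh \<open>2\<^sup>-\<^sup>l\<close>.\<close>

definition grid_time :: "nat \<Rightarrow> ('w \<Rightarrow> nat) \<Rightarrow> bool" where
  "grid_time l R \<longleftrightarrow> (\<forall>j. {\<omega>\<in>space M. j < R \<omega>} \<in> sets (F (real j / 2 ^ l)))"

lemma grid_time_dyadic:
  assumes "optional_time \<tau>" "k \<le> l"
  shows "grid_time l (\<lambda>\<omega>. dyadic_time k (\<tau> \<omega>) * 2 ^ (l - k))"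
  unfolding grid_time_def
proof (rule allI)
  fix j :: nat
  define q where "q = j div 2 ^ (l - k)"
  have nn: "0 \<le> real j / 2 ^ l" by simp
  have eq: "{\<omega>\<in>space M. j < dyadic_time k (\<tau> \<omega>) * 2 ^ (l - k)} =
      (if j < k * 2 ^ l then space M - {\<omega>\<in>space M. \<tau> \<omega> < real q / 2 ^ k} else {})"
    using assms by (auto simp: dyadic_time_refine_less_iff q_def optional_time_def)
  have "{\<omega>\<in>space M. \<tau> \<omega> < real q / 2 ^ k} \<in> sets (F (real j / 2 ^ l))"
  proof (cases "q = 0")
    case True
    then have eq: "{\<omega>\<in>space M. \<tau> \<omega> < real q / 2 ^ k} = {}"
      using assms by (auto simp: optional_time_def not_less)
    show ?thesis unfolding eq by (rule sets.empty_sets)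
  next
    case False
    have "q * 2 ^ (l - k) \<le> j" unfolding q_def by simp
    then have "real (q * 2 ^ (l - k)) \<le> real j" by (rule of_nat_mono)
    moreover have "(2::real) ^ l = 2 ^ k * 2 ^ (l - k)" using assms(2) by (simp add: power_add[symmetric])
    ultimately have "real q / 2 ^ k \<le> real j / 2 ^ l" by (simp add: field_simps)
    moreover have "0 < real q / 2 ^ k" using False by simp
    ultimately show ?thesis
      using assms(1) F_mono[of "real q / 2 ^ k" "real j / 2 ^ l"] by (auto simp: optional_time_def)
  qed
  then show "{\<omega>\<in>space M. j < dyadic_time k (\<tau> \<omega>) * 2 ^ (l - k)} \<in> sets (F (real j / 2 ^ l))"
    unfolding eq using sets.compl_sets[of _ "F (real j / 2 ^ l)"] space_F[OF nn] by auto
qed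

lemma grid_time_measurable:
  assumes "grid_time l R" shows "R \<in> measurable M (count_space UNIV)"
proof -
  have "{\<omega>\<in>space M. j < R \<omega>} \<in> sets M" for j
    by (rule sets_F_subset[of "real j / 2 ^ l"]) (use assms in \<open>simp_all add: grid_time_def\<close>)
  then have *: "{\<omega>\<in>space M. R \<omega> \<le> j} \<in> sets M" for j
    using sets.sets_Collect_neg[of M "\<lambda>\<omega>. j < R \<omega>"] by (simp add: not_less)
  have "R -` {n} \<inter> space M \<in> sets M" for n
  proof (cases n)
    case 0
    then have eq: "R -` {n} \<inter> space M = {\<omega>\<in>space M. R \<omega> \<le> 0}" by auto
    show ?thesis unfolding eq by (rule *)
  next
    case (Suc m)
    then have "R -` {n} \<inter> space M = {\<omega>\<in>space M. R \<omega> \<le> n} - {\<omega>\<in>space M. R \<omega> \<le> m}" by auto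
    then show ?thesis using * by simp
  qed
  then show ?thesis
    by (simp add: measurable_count_space_eq_countable)
qed

text \<open>The discrete stochastic integral of the weights \<open>\<eta>\<close> over the first \<open>n\<close> cells of the grid of mesh \<open>2\<^sup>-\<^sup>l\<close>.\<close>

definition grid_sum :: "nat \<Rightarrow> (nat \<Rightarrow> 'w \<Rightarrow> real) \<Rightarrow> nat \<Rightarrow> 'w \<Rightarrow> 'a" where
  "grid_sum l \<eta> n \<omega> = (\<Sum>j<n. \<eta> j \<omega> *\<^sub>R (Z (real (Suc j) / 2 ^ l) \<omega> - Z (real j / 2 ^ l) \<omega>))"

text \<open>
  The terms of a sum with weights from the past are centred and pairwise orthogonal, so second moments add up.
\<close>

lemma grid_sum_moments:
  assumes \<eta>: "\<And>j. \<eta> j \<in> borel_measurable (F (real j / 2 ^ l))" "\<And>j \<omega>. \<bar>\<eta> j \<omega>\<bar> \<le> 1"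
    and Z: "\<And>t. 0 \<le> t \<Longrightarrow> integrable M (Z t)" "\<And>t. 0 \<le> t \<Longrightarrow> (\<integral>\<omega>. Z t \<omega> \<partial>M) = 0"
  shows grid_sum_measurable: "grid_sum l \<eta> n \<in> borel_measurable (F (real n / 2 ^ l))"
    and grid_sum_integrable: "integrable M (grid_sum l \<eta> n)"
    and grid_sum_mean: "(\<integral>\<omega>. grid_sum l \<eta> n \<omega> \<partial>M) = 0"
    and grid_sum_second_moment:
      "(\<And>t. 0 \<le> t \<Longrightarrow> integrable M (\<lambda>\<omega>. (norm (Z t \<omega>))\<^sup>2)) \<Longrightarrow>
       (\<And>t. 0 \<le> t \<Longrightarrow> (\<integral>\<omega>. (norm (Z t \<omega>))\<^sup>2 \<partial>M) = C * t) \<Longrightarrow>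
       integrable M (\<lambda>\<omega>. (norm (grid_sum l \<eta> n \<omega>))\<^sup>2) \<and>
       (\<integral>\<omega>. (norm (grid_sum l \<eta> n \<omega>))\<^sup>2 \<partial>M) = C / 2 ^ l * (\<integral>\<omega>. (\<Sum>j<n. (\<eta> j \<omega>)\<^sup>2) \<partial>M)"
proof -
  define s where "s j = real j / 2 ^ l" for j
  define \<xi> where "\<xi> j \<omega> = Z (s (Suc j)) \<omega> - Z (s j) \<omega>" for j \<omega>
  have G: "grid_sum l \<eta> n = (\<lambda>\<omega>. \<Sum>j<n. \<eta> j \<omega> *\<^sub>R \<xi> j \<omega>)" for n
    by (auto simp: grid_sum_def s_def \<xi>_def)
  have s0: "0 \<le> s j" for j by (simp add: s_def)
  have s_mono: "s i \<le> s j" if "i \<le> j" for i j using that by (simp add: s_def divide_right_mono)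
  have \<eta>M [measurable]: "\<eta> j \<in> borel_measurable M" for j
    by (rule measurable_F_M[OF s0]) (use \<eta> in \<open>simp add: s_def\<close>)
  have \<xi>i: "integrable M (\<xi> j)" for j unfolding \<xi>_def using Z(1) s0 by auto
  have \<xi>M [measurable]: "\<xi> j \<in> borel_measurable M" for j using \<xi>i by auto
  have \<eta>F: "\<eta> j \<in> borel_measurable (F (s n))" if "j \<le> n" for j n
    by (rule measurable_F_mono[OF s0[of j] s_mono[OF that]]) (use \<eta> in \<open>simp add: s_def\<close>)
  have "\<xi> j \<in> borel_measurable (F (s n))" if "j < n" for j n
    unfolding \<xi>_def using adapted_mono[OF s0 s_mono, of "Suc j" n] adapted_mono[OF s0 s_mono, of j n] that
    by (intro borel_measurable_diff) auto
  then have meas: "grid_sum l \<eta> n \<in> borel_measurable (F (s n))" for n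
    unfolding G using \<eta>F by (intro borel_measurable_sum borel_measurable_scaleR) auto
  then show "grid_sum l \<eta> n \<in> borel_measurable (F (real n / 2 ^ l))" by (simp add: s_def)
  have bnd: "norm (\<eta> j \<omega> *\<^sub>R x) \<le> norm x" for j \<omega> and x :: 'a
    using mult_right_mono[OF \<eta>(2)[of j \<omega>] norm_ge_zero[of x]] by simp
  have ti: "integrable M (\<lambda>\<omega>. \<eta> j \<omega> *\<^sub>R \<xi> j \<omega>)" for j
    by (rule Bochner_Integration.integrable_bound[OF \<xi>i[of j]]) (use bnd in auto)
  show int: "integrable M (grid_sum l \<eta> n)" for n
    unfolding G using ti by (intro Bochner_Integration.integrable_sum)
  have ti0: "(\<integral>\<omega>. \<eta> j \<omega> *\<^sub>R \<xi> j \<omega> \<partial>M) = 0" for j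
  proof (rule euclidean_eqI)
    fix b :: 'a assume "b \<in> Basis"
    have "(\<integral>\<omega>. \<eta> j \<omega> *\<^sub>R \<xi> j \<omega> \<partial>M) \<bullet> b = (\<integral>\<omega>. (\<eta> j \<omega> *\<^sub>R \<xi> j \<omega>) \<bullet> b \<partial>M)"
      by (rule integral_inner_left[symmetric]) (use ti in simp)
    also have "\<dots> = (\<integral>\<omega>. (\<eta> j \<omega> *\<^sub>R b) \<bullet> (Z (s (Suc j)) \<omega> - Z (s j) \<omega>) \<partial>M)"
      by (simp add: \<xi>_def inner_commute)
    also have "\<dots> = 0"
    proof (rule inner_increment(2))
      show "integrable M (\<lambda>\<omega>. \<eta> j \<omega> *\<^sub>R b)"
        by (rule integrable_const_bound[of _ "norm b"]) (use bnd in auto)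
      show "(\<lambda>\<omega>. \<eta> j \<omega> *\<^sub>R b) \<in> borel_measurable (F (s j))"
        using \<eta>F[of j j] by measurable
    qed (use s0 s_mono Z in auto)
    finally show "(\<integral>\<omega>. \<eta> j \<omega> *\<^sub>R \<xi> j \<omega> \<partial>M) \<bullet> b = 0 \<bullet> b" by simp
  qed
  show "(\<integral>\<omega>. grid_sum l \<eta> n \<omega> \<partial>M) = 0"
    unfolding G by (subst Bochner_Integration.integral_sum) (use ti ti0 in auto)
  assume sq: "\<And>t. 0 \<le> t \<Longrightarrow> integrable M (\<lambda>\<omega>. (norm (Z t \<omega>))\<^sup>2)"
    "\<And>t. 0 \<le> t \<Longrightarrow> (\<integral>\<omega>. (norm (Z t \<omega>))\<^sup>2 \<partial>M) = C * t"
  have \<xi>2: "integrable M (\<lambda>\<omega>. (norm (\<xi> j \<omega>))\<^sup>2)" "(\<integral>\<omega>. (norm (\<xi> j \<omega>))\<^sup>2 \<partial>M) = C / 2 ^ l" for j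
  proof -
    have d: "s (Suc j) - s j = 1 / 2 ^ l" by (simp add: s_def field_simps)
    show "integrable M (\<lambda>\<omega>. (norm (\<xi> j \<omega>))\<^sup>2)"
      unfolding \<xi>_def by (subst integral_increment(2)) (use s0 s_mono sq d in auto)
    show "(\<integral>\<omega>. (norm (\<xi> j \<omega>))\<^sup>2 \<partial>M) = C / 2 ^ l"
      unfolding \<xi>_def by (subst integral_increment(1)) (use s0 s_mono sq d in auto)
  qed
  have \<eta>2: "integrable M (\<lambda>\<omega>. (\<eta> j \<omega>)\<^sup>2)" for j
    by (rule integrable_const_bound[of _ 1]) (use \<eta>(2) in \<open>auto simp: abs_square_le_1\<close>)
  \<comment> \<open>both variables of \<open>indep_var\<close> have the same type, so the weight is carried by a unit vector\<close>
  have ind: "indep_var borel (\<lambda>\<omega>. (\<eta> j \<omega>)\<^sup>2) borel (\<lambda>\<omega>. (norm (\<xi> j \<omega>))\<^sup>2)" for j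
  proof -
    obtain b :: 'a where "b \<in> Basis" using nonempty_Basis by blast
    then have b: "norm b = 1" by simp
    have "(\<lambda>\<omega>. \<eta> j \<omega> *\<^sub>R b) \<in> borel_measurable (F (s j))"
      using \<eta>F[of j j] by measurable
    from indep_var_compose[OF indep_var_increment[OF s0[of j] s_mono[of j "Suc j"] this],
        of "\<lambda>x. (norm x)\<^sup>2" borel "\<lambda>x. (norm x)\<^sup>2" borel]
    show ?thesis by (simp add: comp_def \<xi>_def b)
  qed
  show "integrable M (\<lambda>\<omega>. (norm (grid_sum l \<eta> n \<omega>))\<^sup>2) \<and>
       (\<integral>\<omega>. (norm (grid_sum l \<eta> n \<omega>))\<^sup>2 \<partial>M) = C / 2 ^ l * (\<integral>\<omega>. (\<Sum>j<n. (\<eta> j \<omega>)\<^sup>2) \<partial>M)"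
  proof (induction n)
    case 0
    then show ?case by (simp add: grid_sum_def)
  next
    case (Suc n)
    let ?G = "grid_sum l \<eta> n"
    let ?c = "\<lambda>\<omega>. (\<eta> n \<omega> *\<^sub>R ?G \<omega>) \<bullet> \<xi> n \<omega>"
    let ?e = "\<lambda>\<omega>. (\<eta> n \<omega>)\<^sup>2 * (norm (\<xi> n \<omega>))\<^sup>2"
    have c: "integrable M ?c" "integral\<^sup>L M ?c = 0"
    proof -
      have m: "(\<lambda>\<omega>. \<eta> n \<omega> *\<^sub>R ?G \<omega>) \<in> borel_measurable (F (s n))"
        using \<eta>F[of n n] meas[of n] by (intro borel_measurable_scaleR) auto
      have i: "integrable M (\<lambda>\<omega>. \<eta> n \<omega> *\<^sub>R ?G \<omega>)"
        by (rule Bochner_Integration.integrable_bound[OF int[of n]])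
          (use bnd int[of n] in auto)
      have le: "s n \<le> s (Suc n)" by (rule s_mono) simp
      show "integrable M ?c" "integral\<^sup>L M ?c = 0"
        unfolding \<xi>_def by (rule inner_increment[OF s0 le m i Z]; assumption)+
    qed
    have e: "integrable M ?e" "integral\<^sup>L M ?e = (\<integral>\<omega>. (\<eta> n \<omega>)\<^sup>2 \<partial>M) * (C / 2 ^ l)"
      using indep_var_integrable[OF ind \<eta>2 \<xi>2(1), of n]
        indep_var_lebesgue_integral[OF ind \<eta>2 \<xi>2(1), of n] by (auto simp: \<xi>2(2))
    have eq: "(\<lambda>\<omega>. (norm (grid_sum l \<eta> (Suc n) \<omega>))\<^sup>2) = (\<lambda>\<omega>. (norm (?G \<omega>))\<^sup>2 + 2 * ?c \<omega> + ?e \<omega>)"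
    proof
      fix \<omega>
      have "(norm (grid_sum l \<eta> (Suc n) \<omega>))\<^sup>2 = (norm (?G \<omega> + \<eta> n \<omega> *\<^sub>R \<xi> n \<omega>))\<^sup>2" by (simp add: G)
      also have "\<dots> = (norm (?G \<omega>))\<^sup>2 + 2 * ?c \<omega> + ?e \<omega>"
        by (simp only: power2_norm_eq_inner)
          (simp add: inner_add_left inner_add_right inner_commute power2_eq_square algebra_simps)
      finally show "(norm (grid_sum l \<eta> (Suc n) \<omega>))\<^sup>2 = (norm (?G \<omega>))\<^sup>2 + 2 * ?c \<omega> + ?e \<omega>" .
    qed
    have sumi: "integrable M (\<lambda>\<omega>. \<Sum>j<n. (\<eta> j \<omega>)\<^sup>2)" using \<eta>2 by auto
    show ?case unfolding eq using Suc c e sumi \<eta>2[of n] by (simp add: algebra_simps)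
  qed
qed

end

section \<open>Wald's identities\<close>

context adapted_increments
begin

lemma Z_at_grid_time:
  assumes R: "\<And>\<omega>. R \<omega> \<le> n" and \<omega>: "\<omega> \<in> space M"
  shows "Z (real (R \<omega>) / 2 ^ l) \<omega> = grid_sum l (\<lambda>j \<omega>. of_bool (j < R \<omega>)) n \<omega>"
  using sum_stopped_increments[OF R, where f = "\<lambda>j. Z (real j / 2 ^ l) \<omega>"] start_0[OF \<omega>]
  by (simp add: grid_sum_def)

lemma grid_time_weight_measurable:
  assumes "grid_time l R"
  shows "(\<lambda>\<omega>. of_bool (j < R \<omega>) :: real) \<in> borel_measurable (F (real j / 2 ^ l))"
proof -
  have "{\<omega>\<in>space (F (real j / 2 ^ l)). j < R \<omega>} \<in> sets (F (real j / 2 ^ l))"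
    using assms by (simp add: grid_time_def)
  then have "(\<lambda>\<omega>. indicator {\<omega>\<in>space (F (real j / 2 ^ l)). j < R \<omega>} \<omega> :: real) \<in> borel_measurable (F (real j / 2 ^ l))"
    by (rule borel_measurable_indicator)
  then show ?thesis
    by (rule measurable_cong[THEN iffD1, rotated]) (auto simp: indicator_def)
qed

lemma Z_at_grid_time_measurable:
  assumes "grid_time l R" "\<And>\<omega>. R \<omega> \<le> n"
  shows "(\<lambda>\<omega>. Z (real (R \<omega>) / 2 ^ l) \<omega>) \<in> borel_measurable M"
proof -
  have [measurable]: "(\<lambda>\<omega>. of_bool (j < R \<omega>) :: real) \<in> borel_measurable M" for j
    by (rule measurable_F_M[OF _ grid_time_weight_measurable[OF assms(1)]]) simp
  have [measurable]: "Z (real j / 2 ^ l) \<in> borel_measurable M" for j by simp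
  have "grid_sum l (\<lambda>j \<omega>. of_bool (j < R \<omega>)) n \<in> borel_measurable M"
    unfolding grid_sum_def by measurable
  then show ?thesis
    using Z_at_grid_time[OF assms(2)] by (subst measurable_cong) auto
qed

lemma wald_grid_mean:
  assumes R: "grid_time l R" "\<And>\<omega>. R \<omega> \<le> n"
    and Z: "\<And>t. 0 \<le> t \<Longrightarrow> integrable M (Z t)" "\<And>t. 0 \<le> t \<Longrightarrow> (\<integral>\<omega>. Z t \<omega> \<partial>M) = 0"
  shows "(\<integral>\<omega>. Z (real (R \<omega>) / 2 ^ l) \<omega> \<partial>M) = 0"
proof -
  have "(\<integral>\<omega>. Z (real (R \<omega>) / 2 ^ l) \<omega> \<partial>M) = (\<integral>\<omega>. grid_sum l (\<lambda>j \<omega>. of_bool (j < R \<omega>)) n \<omega> \<partial>M)"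
    by (rule Bochner_Integration.integral_cong[OF refl Z_at_grid_time[OF R(2)]])
  also have "\<dots> = 0"
    by (rule grid_sum_mean[OF grid_time_weight_measurable[OF R(1)] _ Z]) auto
  finally show ?thesis .
qed

text \<open>
  The difference of the values at two grid times is a weighted sum of increments with weights \<open>-1\<close>, 0 and 1.
\<close>

lemma wald_grid_second_moment:
  assumes R: "grid_time l R" "\<And>\<omega>. R \<omega> \<le> n" and R': "grid_time l R'" "\<And>\<omega>. R' \<omega> \<le> n"
    and Z: "\<And>t. 0 \<le> t \<Longrightarrow> integrable M (Z t)" "\<And>t. 0 \<le> t \<Longrightarrow> (\<integral>\<omega>. Z t \<omega> \<partial>M) = 0"
    and sq: "\<And>t. 0 \<le> t \<Longrightarrow> integrable M (\<lambda>\<omega>. (norm (Z t \<omega>))\<^sup>2)"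
       "\<And>t. 0 \<le> t \<Longrightarrow> (\<integral>\<omega>. (norm (Z t \<omega>))\<^sup>2 \<partial>M) = C * t"
  defines "Q \<equiv> \<lambda>\<omega>. (norm (Z (real (R \<omega>) / 2 ^ l) \<omega> - Z (real (R' \<omega>) / 2 ^ l) \<omega>))\<^sup>2"
  shows "integrable M Q"
    "integral\<^sup>L M Q = C * (\<integral>\<omega>. \<bar>real (R \<omega>) / 2 ^ l - real (R' \<omega>) / 2 ^ l\<bar> \<partial>M)"
proof -
  define \<eta> :: "nat \<Rightarrow> 'w \<Rightarrow> real" where "\<eta> j \<omega> = of_bool (j < R \<omega>) - of_bool (j < R' \<omega>)" for j \<omega>
  have m: "\<eta> j \<in> borel_measurable (F (real j / 2 ^ l))" for j
    unfolding \<eta>_def[abs_def]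
    by (intro borel_measurable_diff grid_time_weight_measurable R(1) R'(1))
  have b: "\<bar>\<eta> j \<omega>\<bar> \<le> 1" for j \<omega> by (simp add: \<eta>_def)
  have sm: "integrable M (\<lambda>\<omega>. (norm (grid_sum l \<eta> n \<omega>))\<^sup>2)"
    "(\<integral>\<omega>. (norm (grid_sum l \<eta> n \<omega>))\<^sup>2 \<partial>M) = C / 2 ^ l * (\<integral>\<omega>. (\<Sum>j<n. (\<eta> j \<omega>)\<^sup>2) \<partial>M)"
    using grid_sum_second_moment[where \<eta> = \<eta>, OF m b Z sq] by auto
  have eq: "Q \<omega> = (norm (grid_sum l \<eta> n \<omega>))\<^sup>2" if "\<omega> \<in> space M" for \<omega>
    unfolding Q_def Z_at_grid_time[of R n, OF R(2) that] Z_at_grid_time[of R' n, OF R'(2) that]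
    by (simp only: grid_sum_def \<eta>_def sum_subtractf[symmetric] scaleR_left_diff_distrib)
  show "integrable M Q"
    by (subst Bochner_Integration.integrable_cong[OF refl eq]) (use sm(1) in auto)
  have "integral\<^sup>L M Q = C / 2 ^ l * (\<integral>\<omega>. \<bar>real (R \<omega>) - real (R' \<omega>)\<bar> \<partial>M)"
    unfolding sm(2)[unfolded \<eta>_def sum_square_of_bool_diff[OF R(2) R'(2)], symmetric] \<eta>_def[symmetric]
    by (rule Bochner_Integration.integral_cong[OF refl eq])
  also have "\<dots> = C * (\<integral>\<omega>. \<bar>real (R \<omega>) - real (R' \<omega>)\<bar> / 2 ^ l \<partial>M)" by simp
  also have "(\<lambda>\<omega>. \<bar>real (R \<omega>) - real (R' \<omega>)\<bar> / 2 ^ l) =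
      (\<lambda>\<omega>. \<bar>real (R \<omega>) / 2 ^ l - real (R' \<omega>) / 2 ^ l\<bar>)"
    by (simp add: diff_divide_distrib[symmetric])
  finally show "integral\<^sup>L M Q = C * (\<integral>\<omega>. \<bar>real (R \<omega>) / 2 ^ l - real (R' \<omega>) / 2 ^ l\<bar> \<partial>M)" .
qed

text \<open>The level \<open>k\<close> discretisation of a random time, converging to it from the right.\<close>

definition approx_time :: "('w \<Rightarrow> real) \<Rightarrow> nat \<Rightarrow> 'w \<Rightarrow> real" where
  "approx_time \<tau> k \<omega> = real (dyadic_time k (\<tau> \<omega>)) / 2 ^ k"

lemma approx_time_refine:
  assumes "k \<le> l"
  shows "approx_time \<tau> k \<omega> = real (dyadic_time k (\<tau> \<omega>) * 2 ^ (l - k)) / 2 ^ l"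
proof -
  have "(2::real) ^ l = 2 ^ k * 2 ^ (l - k)" using assms by (simp add: power_add[symmetric])
  then show ?thesis by (simp add: approx_time_def)
qed

lemma dyadic_time_bound:
  assumes "k \<le> l" shows "dyadic_time k u * 2 ^ (l - k) \<le> l * 2 ^ l"
proof -
  have "dyadic_time k u * 2 ^ (l - k) \<le> k * 2 ^ k * 2 ^ (l - k)"
    by (simp add: dyadic_time_def)
  also have "\<dots> = k * 2 ^ l" using assms by (simp add: power_add[symmetric])
  also have "\<dots> \<le> l * 2 ^ l" using assms by simp
  finally show ?thesis .
qed

lemma approx_time_measurable:
  assumes "optional_time \<tau>" shows "approx_time \<tau> k \<in> borel_measurable M"
proof -
  have "(\<lambda>\<omega>. dyadic_time k (\<tau> \<omega>)) \<in> measurable M (count_space UNIV)"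
    using grid_time_measurable[OF grid_time_dyadic[OF assms order_refl[of k]]] by simp
  then show ?thesis unfolding approx_time_def[abs_def] by measurable
qed

lemma approx_time_tendsto:
  assumes "optional_time \<tau>" "\<omega> \<in> space M"
  shows "(\<lambda>k. approx_time \<tau> k \<omega>) \<longlonglongrightarrow> \<tau> \<omega>"
    and "(\<lambda>k. Z (approx_time \<tau> k \<omega>) \<omega>) \<longlonglongrightarrow> Z (\<tau> \<omega>) \<omega>"
proof -
  have 0: "0 \<le> \<tau> \<omega>" using assms by (simp add: optional_time_def)
  note * = dyadic_time_tendsto[OF 0]
  show "(\<lambda>k. approx_time \<tau> k \<omega>) \<longlonglongrightarrow> \<tau> \<omega>"
    using * unfolding filterlim_at approx_time_def by blast
  show "(\<lambda>k. Z (approx_time \<tau> k \<omega>) \<omega>) \<longlonglongrightarrow> Z (\<tau> \<omega>) \<omega>"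
    unfolding approx_time_def
    by (rule filterlim_compose[OF right_cont[OF assms(2) 0] *])
qed

lemma approx_time_bounds:
  assumes "optional_time \<tau>" "\<omega> \<in> space M"
  shows "0 \<le> approx_time \<tau> k \<omega>" "approx_time \<tau> k \<omega> \<le> real (nat \<lfloor>\<tau> \<omega>\<rfloor> + 1)"
    "approx_time \<tau> k \<omega> \<le> \<tau> \<omega> + 1"
proof -
  have 0: "0 \<le> \<tau> \<omega>" using assms by (simp add: optional_time_def)
  show "0 \<le> approx_time \<tau> k \<omega>" by (simp add: approx_time_def)
  show *: "approx_time \<tau> k \<omega> \<le> real (nat \<lfloor>\<tau> \<omega>\<rfloor> + 1)"
    unfolding approx_time_def by (rule dyadic_time_le[OF 0])
  have "real (nat \<lfloor>\<tau> \<omega>\<rfloor>) \<le> \<tau> \<omega>" using 0 by (rule of_nat_floor)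
  then show "approx_time \<tau> k \<omega> \<le> \<tau> \<omega> + 1" using * by simp
qed

lemma Z_approx_time_measurable:
  assumes "optional_time \<tau>" shows "(\<lambda>\<omega>. Z (approx_time \<tau> k \<omega>) \<omega>) \<in> borel_measurable M"
  unfolding approx_time_def
  by (rule Z_at_grid_time_measurable[of k "\<lambda>\<omega>. dyadic_time k (\<tau> \<omega>)" "k * 2 ^ k"])
    (use grid_time_dyadic[OF assms order_refl[of k]] in \<open>auto simp: dyadic_time_def\<close>)

lemma Z_optional_time_measurable:
  assumes "optional_time \<tau>" shows "(\<lambda>\<omega>. Z (\<tau> \<omega>) \<omega>) \<in> borel_measurable M"
  by (rule borel_measurable_LIMSEQ_metric[OF Z_approx_time_measurable[OF assms] approx_time_tendsto(2)[OF assms]])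

theorem wald_second_moment:
  assumes \<tau>: "optional_time \<tau>" "integrable M \<tau>"
    and Z: "\<And>t. 0 \<le> t \<Longrightarrow> integrable M (Z t)" "\<And>t. 0 \<le> t \<Longrightarrow> (\<integral>\<omega>. Z t \<omega> \<partial>M) = 0"
    and sq: "\<And>t. 0 \<le> t \<Longrightarrow> integrable M (\<lambda>\<omega>. (norm (Z t \<omega>))\<^sup>2)"
       "\<And>t. 0 \<le> t \<Longrightarrow> (\<integral>\<omega>. (norm (Z t \<omega>))\<^sup>2 \<partial>M) = C * t"
  shows "integrable M (\<lambda>\<omega>. (norm (Z (\<tau> \<omega>) \<omega>))\<^sup>2)"
    and "(\<integral>\<omega>. (norm (Z (\<tau> \<omega>) \<omega>))\<^sup>2 \<partial>M) = C * (\<integral>\<omega>. \<tau> \<omega> \<partial>M)"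
proof -
  define T where "T = approx_time \<tau>"
  define Y where "Y k \<omega> = Z (T k \<omega>) \<omega>" for k \<omega>
  define Y' where "Y' \<omega> = Z (\<tau> \<omega>) \<omega>" for \<omega>
  have [measurable]: "T k \<in> borel_measurable M" "Y k \<in> borel_measurable M" "Y' \<in> borel_measurable M"
    "\<tau> \<in> borel_measurable M" for k
    using approx_time_measurable[OF \<tau>(1)] Z_approx_time_measurable[OF \<tau>(1)] Z_optional_time_measurable[OF \<tau>(1)] \<tau>(2)
    by (auto simp: T_def Y_def[abs_def] Y'_def[abs_def])
  have \<tau>0: "0 \<le> \<tau> \<omega>" if "\<omega> \<in> space M" for \<omega> using \<tau>(1) that by (simp add: optional_time_def)
  have T_bounds: "0 \<le> T k \<omega>" "T k \<omega> \<le> \<tau> \<omega> + 1" if "\<omega> \<in> space M" for k \<omega>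
    using approx_time_bounds[OF \<tau>(1) that] by (auto simp: T_def)
  have T_lim: "(\<lambda>k. T k \<omega>) \<longlonglongrightarrow> \<tau> \<omega>" "(\<lambda>k. Y k \<omega>) \<longlonglongrightarrow> Y' \<omega>" if "\<omega> \<in> space M" for \<omega>
    using approx_time_tendsto[OF \<tau>(1) that] by (auto simp: T_def Y_def Y'_def)
  have dom: "integrable M (\<lambda>\<omega>. \<tau> \<omega> + 1)" using \<tau>(2) by simp
  have C0: "0 \<le> C"
  proof -
    have "0 \<le> (\<integral>\<omega>. (norm (Z 1 \<omega>))\<^sup>2 \<partial>M)" by simp
    then show ?thesis using sq(2)[of 1] by simp
  qed
  have YY: "integrable M (\<lambda>\<omega>. (norm (Y k \<omega> - Y l \<omega>))\<^sup>2)"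
    "(\<integral>\<omega>. (norm (Y k \<omega> - Y l \<omega>))\<^sup>2 \<partial>M) = C * (\<integral>\<omega>. \<bar>T k \<omega> - T l \<omega>\<bar> \<partial>M)" if kl: "k \<le> l" for k l
    using wald_grid_second_moment[OF grid_time_dyadic[OF \<tau>(1) kl] dyadic_time_bound[OF kl]
        grid_time_dyadic[OF \<tau>(1) order_refl[of l]] dyadic_time_bound[OF order_refl[of l]] Z sq]
    by (simp_all add: Y_def T_def approx_time_refine[OF kl] approx_time_refine[OF order_refl[of l]]
        del: of_nat_mult of_nat_power)
  have Y2: "integrable M (\<lambda>\<omega>. (norm (Y k \<omega>))\<^sup>2)"
    "(\<integral>\<omega>. (norm (Y k \<omega>))\<^sup>2 \<partial>M) = C * (\<integral>\<omega>. T k \<omega> \<partial>M)" for k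
  proof -
    have 0: "T 0 \<omega> = 0" for \<omega> by (simp add: T_def approx_time_def dyadic_time_def)
    have eq: "(norm (Y k \<omega>))\<^sup>2 = (norm (Y 0 \<omega> - Y k \<omega>))\<^sup>2" if "\<omega> \<in> space M" for \<omega>
      by (simp add: Y_def 0 start_0[OF that])
    have eq': "\<bar>T 0 \<omega> - T k \<omega>\<bar> = T k \<omega>" if "\<omega> \<in> space M" for \<omega>
      using T_bounds(1)[OF that, of k] by (simp add: 0)
    show "integrable M (\<lambda>\<omega>. (norm (Y k \<omega>))\<^sup>2)"
      using YY(1)[of 0 k] by (subst Bochner_Integration.integrable_cong[OF refl eq]) auto
    show "(\<integral>\<omega>. (norm (Y k \<omega>))\<^sup>2 \<partial>M) = C * (\<integral>\<omega>. T k \<omega> \<partial>M)"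
    proof -
      have "(\<integral>\<omega>. (norm (Y k \<omega>))\<^sup>2 \<partial>M) = (\<integral>\<omega>. (norm (Y 0 \<omega> - Y k \<omega>))\<^sup>2 \<partial>M)"
        by (rule Bochner_Integration.integral_cong[OF refl eq])
      also have "\<dots> = C * (\<integral>\<omega>. \<bar>T 0 \<omega> - T k \<omega>\<bar> \<partial>M)" by (rule YY(2)) simp
      also have "(\<integral>\<omega>. \<bar>T 0 \<omega> - T k \<omega>\<bar> \<partial>M) = (\<integral>\<omega>. T k \<omega> \<partial>M)"
        by (rule Bochner_Integration.integral_cong[OF refl eq'])
      finally show ?thesis .
    qed
  qed
  have Ti: "integrable M (\<lambda>\<omega>. \<bar>T k \<omega> - S \<omega>\<bar>)"
    if "S \<in> borel_measurable M" "\<And>\<omega>. \<omega> \<in> space M \<Longrightarrow> 0 \<le> S \<omega> \<and> S \<omega> \<le> \<tau> \<omega> + 1" for k S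
    by (rule Bochner_Integration.integrable_bound[OF dom])
      (use that T_bounds[of _ k] in \<open>fastforce intro!: AE_I2\<close>)+
  have lim_kl: "(\<lambda>l. \<integral>\<omega>. \<bar>T k \<omega> - T l \<omega>\<bar> \<partial>M) \<longlonglongrightarrow> (\<integral>\<omega>. \<bar>T k \<omega> - \<tau> \<omega>\<bar> \<partial>M)" for k
  proof (rule integral_dominated_convergence[where w = "\<lambda>\<omega>. \<tau> \<omega> + 1"])
    show "AE \<omega> in M. (\<lambda>l. \<bar>T k \<omega> - T l \<omega>\<bar>) \<longlonglongrightarrow> \<bar>T k \<omega> - \<tau> \<omega>\<bar>"
      using T_lim(1) by (intro AE_I2 tendsto_intros)
    show "AE \<omega> in M. norm \<bar>T k \<omega> - T l \<omega>\<bar> \<le> \<tau> \<omega> + 1" for l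
      using T_bounds[of _ k] T_bounds[of _ l] by (intro AE_I2) fastforce
  qed (use dom in auto)
  have lim_k: "(\<lambda>k. \<integral>\<omega>. \<bar>T k \<omega> - \<tau> \<omega>\<bar> \<partial>M) \<longlonglongrightarrow> (\<integral>\<omega>. 0 \<partial>M)"
  proof (rule integral_dominated_convergence[where w = "\<lambda>\<omega>. \<tau> \<omega> + 1"])
    show "AE \<omega> in M. (\<lambda>k. \<bar>T k \<omega> - \<tau> \<omega>\<bar>) \<longlonglongrightarrow> 0"
      using T_lim(1) by (intro AE_I2 tendsto_rabs_zero LIM_zero)
    show "AE \<omega> in M. norm \<bar>T k \<omega> - \<tau> \<omega>\<bar> \<le> \<tau> \<omega> + 1" for k
      using T_bounds[of _ k] \<tau>0 by (intro AE_I2) fastforce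
  qed (use dom in auto)
  have lim_T: "(\<lambda>k. \<integral>\<omega>. T k \<omega> \<partial>M) \<longlonglongrightarrow> (\<integral>\<omega>. \<tau> \<omega> \<partial>M)"
  proof (rule integral_dominated_convergence[where w = "\<lambda>\<omega>. \<tau> \<omega> + 1"])
    show "AE \<omega> in M. norm (T k \<omega>) \<le> \<tau> \<omega> + 1" for k
      using T_bounds[of _ k] by (intro AE_I2) fastforce
  qed (use dom T_lim(1) in auto)

  \<comment> \<open>Fatou's lemma bounds the mean square distance to the limit.\<close>
  define q where "q k = C * (\<integral>\<omega>. \<bar>T k \<omega> - \<tau> \<omega>\<bar> \<partial>M)" for k
  have fatou: "(\<integral>\<^sup>+\<omega>. ennreal ((norm (Y k \<omega> - Y' \<omega>))\<^sup>2) \<partial>M) \<le> ennreal (q k)" for k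
  proof -
    have "(\<integral>\<^sup>+\<omega>. ennreal ((norm (Y k \<omega> - Y' \<omega>))\<^sup>2) \<partial>M) =
        (\<integral>\<^sup>+\<omega>. liminf (\<lambda>l. ennreal ((norm (Y k \<omega> - Y l \<omega>))\<^sup>2)) \<partial>M)"
    proof (rule nn_integral_cong)
      fix \<omega> assume "\<omega> \<in> space M"
      then have "(\<lambda>l. ennreal ((norm (Y k \<omega> - Y l \<omega>))\<^sup>2)) \<longlonglongrightarrow> ennreal ((norm (Y k \<omega> - Y' \<omega>))\<^sup>2)"
        by (intro tendsto_intros T_lim)
      then show "ennreal ((norm (Y k \<omega> - Y' \<omega>))\<^sup>2) = liminf (\<lambda>l. ennreal ((norm (Y k \<omega> - Y l \<omega>))\<^sup>2))"
        by (rule lim_imp_Liminf[OF sequentially_bot, symmetric])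
    qed
    also have "\<dots> \<le> liminf (\<lambda>l. \<integral>\<^sup>+\<omega>. ennreal ((norm (Y k \<omega> - Y l \<omega>))\<^sup>2) \<partial>M)"
      by (rule nn_integral_liminf) measurable
    also have "(\<lambda>l. \<integral>\<^sup>+\<omega>. ennreal ((norm (Y k \<omega> - Y l \<omega>))\<^sup>2) \<partial>M) \<longlonglongrightarrow> ennreal (q k)"
    proof (rule Lim_transform_eventually)
      show "(\<lambda>l. ennreal (C * (\<integral>\<omega>. \<bar>T k \<omega> - T l \<omega>\<bar> \<partial>M))) \<longlonglongrightarrow> ennreal (q k)"
        unfolding q_def by (intro tendsto_ennrealI tendsto_mult tendsto_const lim_kl)
      show "eventually (\<lambda>l. ennreal (C * (\<integral>\<omega>. \<bar>T k \<omega> - T l \<omega>\<bar> \<partial>M)) =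
          (\<integral>\<^sup>+\<omega>. ennreal ((norm (Y k \<omega> - Y l \<omega>))\<^sup>2) \<partial>M)) sequentially"
        using eventually_ge_at_top[of k]
        by eventually_elim (simp add: nn_integral_eq_integral YY)
    qed
    then have "liminf (\<lambda>l. \<integral>\<^sup>+\<omega>. ennreal ((norm (Y k \<omega> - Y l \<omega>))\<^sup>2) \<partial>M) = ennreal (q k)"
      by (simp add: lim_imp_Liminf)
    finally show ?thesis .
  qed
  have Di: "integrable M (\<lambda>\<omega>. (norm (Y k \<omega> - Y' \<omega>))\<^sup>2)" for k
    using fatou[of k] by (intro integrableI_nonneg) (auto intro: le_less_trans)
  have q0: "0 \<le> q k" for k unfolding q_def using C0 by simp
  have D: "(\<integral>\<omega>. (norm (Y k \<omega> - Y' \<omega>))\<^sup>2 \<partial>M) \<le> q k" for k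
    using fatou[of k] q0 by (simp add: nn_integral_eq_integral[OF Di])
  have q_lim: "q \<longlonglongrightarrow> 0"
    using tendsto_mult[OF tendsto_const[of C] lim_k] by (simp add: q_def[abs_def])
  show int: "integrable M (\<lambda>\<omega>. (norm (Z (\<tau> \<omega>) \<omega>))\<^sup>2)"
  proof (rule Bochner_Integration.integrable_bound)
    show "integrable M (\<lambda>\<omega>. 2 * (norm (Y 0 \<omega>))\<^sup>2 + 2 * (norm (Y 0 \<omega> - Y' \<omega>))\<^sup>2)"
      using Y2(1) Di by simp
    have "(norm y)\<^sup>2 \<le> 2 * (norm x)\<^sup>2 + 2 * (norm (x - y))\<^sup>2" for x y :: 'a
    proof -
      have "(norm y)\<^sup>2 \<le> (norm x + norm (x - y))\<^sup>2"
        using norm_triangle_ineq4[of x "x - y"] by (intro power_mono) auto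
      also have "\<dots> \<le> 2 * (norm x)\<^sup>2 + 2 * (norm (x - y))\<^sup>2"
        using sum_squares_ge_zero[of "norm x - norm (x - y)" 0]
        by (simp add: power2_eq_square algebra_simps)
      finally show ?thesis .
    qed
    then show "AE \<omega> in M. norm ((norm (Z (\<tau> \<omega>) \<omega>))\<^sup>2) \<le> norm (2 * (norm (Y 0 \<omega>))\<^sup>2 + 2 * (norm (Y 0 \<omega> - Y' \<omega>))\<^sup>2)"
      by (intro AE_I2) (simp add: Y'_def)
  qed (use \<open>Y' \<in> borel_measurable M\<close> in \<open>simp add: Y'_def[abs_def]\<close>)
  define m where "m = (\<integral>\<omega>. (norm (Y' \<omega>))\<^sup>2 \<partial>M)"
  have Y'i: "integrable M (\<lambda>\<omega>. (norm (Y' \<omega>))\<^sup>2)" using int by (simp add: Y'_def)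
  have m0: "0 \<le> m" by (simp add: m_def)
  \<comment> \<open>convergence of the norms in mean square, with \<open>2 d |y| \<le> d\<^sup>2 / e + e |y|\<^sup>2\<close> in place of the triangle inequality\<close>
  have close: "\<bar>C * (\<integral>\<omega>. \<tau> \<omega> \<partial>M) - m\<bar> \<le> e * m" if e: "0 < e" for e
  proof (rule LIMSEQ_le)
    show "(\<lambda>k. \<bar>C * (\<integral>\<omega>. T k \<omega> \<partial>M) - m\<bar>) \<longlonglongrightarrow> \<bar>C * (\<integral>\<omega>. \<tau> \<omega> \<partial>M) - m\<bar>"
      by (intro tendsto_intros lim_T)
    show "(\<lambda>k. (1 + 1 / e) * q k + e * m) \<longlonglongrightarrow> e * m"
      by (rule tendsto_eq_intros q_lim refl | simp)+
    have pt: "\<bar>(norm x)\<^sup>2 - (norm y)\<^sup>2\<bar> \<le> (1 + 1 / e) * (norm (x - y))\<^sup>2 + e * (norm y)\<^sup>2" for x y :: 'a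
    proof -
      define d where "d = norm (x - y)"
      have "\<bar>norm x - norm y\<bar> \<le> d" unfolding d_def by (rule norm_triangle_ineq3)
      then have "\<bar>norm x - norm y\<bar> * (norm x + norm y) \<le> d * (d + 2 * norm y)"
        by (intro mult_mono) auto
      moreover have "\<bar>(norm x)\<^sup>2 - (norm y)\<^sup>2\<bar> = \<bar>norm x - norm y\<bar> * (norm x + norm y)"
        by (simp add: power2_eq_square square_diff_square_factored abs_mult)
      moreover have "2 * (d * norm y) \<le> 1 / e * d\<^sup>2 + e * (norm y)\<^sup>2"
      proof -
        have "0 \<le> (d - e * norm y)\<^sup>2 / e" using e by simp
        also have "\<dots> = 1 / e * d\<^sup>2 + e * (norm y)\<^sup>2 - 2 * (d * norm y)"
          using e by (simp add: power2_eq_square field_simps)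
        finally show ?thesis by simp
      qed
      ultimately show ?thesis by (simp add: d_def[symmetric] power2_eq_square algebra_simps)
    qed
    have "\<bar>C * (\<integral>\<omega>. T k \<omega> \<partial>M) - m\<bar> \<le> (1 + 1 / e) * q k + e * m" for k
    proof -
      have "\<bar>C * (\<integral>\<omega>. T k \<omega> \<partial>M) - m\<bar> = \<bar>\<integral>\<omega>. (norm (Y k \<omega>))\<^sup>2 - (norm (Y' \<omega>))\<^sup>2 \<partial>M\<bar>"
        unfolding m_def Y2(2)[symmetric] using Y2(1) Y'i by simp
      also have "\<dots> \<le> (\<integral>\<omega>. \<bar>(norm (Y k \<omega>))\<^sup>2 - (norm (Y' \<omega>))\<^sup>2\<bar> \<partial>M)" by (rule integral_abs_bound)
      also have "\<dots> \<le> (\<integral>\<omega>. (1 + 1 / e) * (norm (Y k \<omega> - Y' \<omega>))\<^sup>2 + e * (norm (Y' \<omega>))\<^sup>2 \<partial>M)"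
        by (intro integral_mono pt) (use Y2(1) Y'i Di in auto)
      also have "\<dots> = (1 + 1 / e) * (\<integral>\<omega>. (norm (Y k \<omega> - Y' \<omega>))\<^sup>2 \<partial>M) + e * m"
        using Y'i Di by (simp add: m_def)
      also have "\<dots> \<le> (1 + 1 / e) * q k + e * m"
        by (intro add_right_mono mult_left_mono D) (use e in auto)
      finally show ?thesis .
    qed
    then show "\<exists>N. \<forall>k\<ge>N. \<bar>C * (\<integral>\<omega>. T k \<omega> \<partial>M) - m\<bar> \<le> (1 + 1 / e) * q k + e * m" by blast
  qed
  have "\<bar>C * (\<integral>\<omega>. \<tau> \<omega> \<partial>M) - m\<bar> \<le> 0"
  proof (rule field_le_epsilon)
    fix \<delta> :: real assume \<delta>: "0 < \<delta>"

    have "\<delta> / (m + 1) * m \<le> \<delta>" using m0 \<delta> by (simp add: field_simps)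
    then show "\<bar>C * (\<integral>\<omega>. \<tau> \<omega> \<partial>M) - m\<bar> \<le> 0 + \<delta>"
      using close[of "\<delta> / (m + 1)"] m0 \<delta> by simp
  qed
  then show "(\<integral>\<omega>. (norm (Z (\<tau> \<omega>) \<omega>))\<^sup>2 \<partial>M) = C * (\<integral>\<omega>. \<tau> \<omega> \<partial>M)"
    by (simp add: m_def Y'_def)
qed

theorem wald_mean:
  assumes \<tau>: "optional_time \<tau>" "integrable M \<tau>"
    and Z: "\<And>t. 0 \<le> t \<Longrightarrow> integrable M (Z t)" "\<And>t. 0 \<le> t \<Longrightarrow> (\<integral>\<omega>. Z t \<omega> \<partial>M) = 0"
  shows "integrable M (\<lambda>\<omega>. Z (\<tau> \<omega>) \<omega>)" and "(\<integral>\<omega>. Z (\<tau> \<omega>) \<omega> \<partial>M) = 0"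
proof -
  define T where "T = approx_time \<tau>"
  define \<mu> where "\<mu> = (\<integral>\<omega>. norm (Z 1 \<omega>) \<partial>M)"
  \<comment> \<open>by Markov's inequality, \<open>|Z v|\<close> exceeds \<open>b\<close> with probability at most 1/2 for all \<open>v \<le> 1\<close>\<close>
  define b where "b = 2 * \<mu> + 1"
  have \<mu>0: "0 \<le> \<mu>" unfolding \<mu>_def by simp
  have b: "0 < b" using \<mu>0 by (simp add: b_def)
  have \<tau>0: "0 \<le> \<tau> \<omega>" if "\<omega> \<in> space M" for \<omega> using \<tau>(1) that by (simp add: optional_time_def)
  have [measurable]: "\<tau> \<in> borel_measurable M" "Z 1 \<in> borel_measurable M" using \<tau> by auto
  have half: "prob {\<omega>\<in>space M. norm (Z v \<omega>) > b} \<le> 1 / 2" if v: "0 \<le> v" "v \<le> 1" for v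
  proof -
    have [measurable]: "Z v \<in> borel_measurable M" using v by simp
    have "prob {\<omega>\<in>space M. norm (Z v \<omega>) > b} \<le> prob {\<omega>\<in>space M. norm (Z v \<omega>) \<ge> b}"
      by (intro finite_measure_mono) auto
    also have "\<dots> \<le> (\<integral>\<omega>. norm (Z v \<omega>) \<partial>M) / b"
      by (rule integral_Markov_inequality_measure[where A = "{}"]) (use Z(1) v b in auto)
    also have "\<dots> \<le> \<mu> / b"
      unfolding \<mu>_def using expectation_norm_mono[OF v Z] b by (intro divide_right_mono) auto
    also have "\<dots> \<le> 1 / 2" using \<mu>0 by (simp add: b_def field_simps)
    finally show ?thesis .
  qed

  \<comment> \<open>\<open>V i\<close> dominates the oscillation of the process during the time interval from \<open>i\<close> to \<open>i + 1\<close>: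
    a real number \<open>x\<close> is at most \<open>b\<close> plus the number of naturals \<open>m\<close> with \<open>m + b < x\<close>.\<close>
  define V where "V i \<omega> = ennreal b + (\<Sum>m. indicator (osc (real i) 1 (real m + b)) \<omega>)" for i :: nat and \<omega>
  define W where "W \<omega> = (\<Sum>i. indicator {\<omega>\<in>space M. real i \<le> \<tau> \<omega>} \<omega> * V i \<omega>)" for \<omega>
  have [measurable]: "osc (real i) 1 c \<in> sets M" for i :: nat and c by simp
  have [measurable]: "V i \<in> borel_measurable M" for i unfolding V_def by measurable
  have [measurable]: "W \<in> borel_measurable M" unfolding W_def by measurable
  have V_ge: "ennreal (norm (Z u \<omega> - Z (real i) \<omega>)) \<le> V i \<omega>"
    if \<omega>: "\<omega> \<in> space M" and u: "real i \<le> u" "u \<le> real i + 1" for i u \<omega>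
  proof -
    define x where "x = norm (Z u \<omega> - Z (real i) \<omega>)"
    define n where "n = nat \<lceil>x - b\<rceil>"
    have x: "x \<le> b + real n" unfolding n_def by linarith
    have "\<omega> \<in> osc (real i) 1 (real m + b)" if "m < n" for m
    proof (rule ccontr)
      assume "\<omega> \<notin> osc (real i) 1 (real m + b)"
      then have "x \<le> real m + b"
        unfolding x_def by (intro norm_le_if_not_osc[OF \<omega>, of "real i" 1]) (use u in auto)
      then show False using that unfolding n_def by linarith
    qed
    then have "(\<Sum>m<n. indicator (osc (real i) 1 (real m + b)) \<omega>) = (\<Sum>m<n. 1 :: ennreal)"
      by (intro sum.cong) auto
    then have "ennreal (real n) = (\<Sum>m<n. indicator (osc (real i) 1 (real m + b)) \<omega>)"
      by (simp add: ennreal_of_nat_eq_real_of_nat)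
    also have "\<dots> \<le> (\<Sum>m. indicator (osc (real i) 1 (real m + b)) \<omega>)"
      by (rule sum_le_suminf) auto
    finally have "ennreal b + ennreal (real n) \<le> V i \<omega>" unfolding V_def by (rule add_left_mono)
    moreover have "ennreal x \<le> ennreal (b + real n)" using x by (rule ennreal_leI)
    ultimately show ?thesis using b by (simp add: x_def ennreal_plus)
  qed
  have path: "ennreal (norm (Z u \<omega>)) \<le> (\<Sum>i\<le>n. V i \<omega>)"
    if \<omega>: "\<omega> \<in> space M" and u: "real n \<le> u" "u \<le> real n + 1" for n u \<omega>
    using u
  proof (induction n arbitrary: u)
    case 0
    then show ?case using V_ge[OF \<omega>, of 0 u] start_0[OF \<omega>] by simp
  next
    case (Suc n)
    have "norm (Z u \<omega>) \<le> norm (Z (real (Suc n)) \<omega>) + norm (Z u \<omega> - Z (real (Suc n)) \<omega>)"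
      using norm_triangle_ineq[of "Z (real (Suc n)) \<omega>" "Z u \<omega> - Z (real (Suc n)) \<omega>"] by simp
    then have "ennreal (norm (Z u \<omega>)) \<le> ennreal (norm (Z (real (Suc n)) \<omega>)) + ennreal (norm (Z u \<omega> - Z (real (Suc n)) \<omega>))"
      by (simp add: ennreal_plus[symmetric] ennreal_leI del: ennreal_plus)
    also have "\<dots> \<le> (\<Sum>i\<le>n. V i \<omega>) + V (Suc n) \<omega>"
      by (intro add_mono Suc.IH V_ge \<omega>) (use Suc.prems in auto)
    finally show ?case by simp
  qed
  have T_le_W: "ennreal (norm (Z (T k \<omega>) \<omega>)) \<le> W \<omega>" if \<omega>: "\<omega> \<in> space M" for k \<omega>
  proof -
    define n where "n = nat \<lfloor>\<tau> \<omega>\<rfloor>"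
    define n' where "n' = min n (nat \<lfloor>T k \<omega>\<rfloor>)"
    have T: "0 \<le> T k \<omega>" "T k \<omega> \<le> real n + 1"
      using approx_time_bounds[OF \<tau>(1) \<omega>, of k] by (simp_all add: T_def n_def)
    have "real n' \<le> T k \<omega>" "T k \<omega> \<le> real n' + 1"
      unfolding n'_def using T by (auto simp: min_def) linarith+
    then have "ennreal (norm (Z (T k \<omega>) \<omega>)) \<le> (\<Sum>i\<le>n'. V i \<omega>)" by (rule path[OF \<omega>])
    also have "\<dots> = (\<Sum>i\<le>n'. indicator {\<omega>\<in>space M. real i \<le> \<tau> \<omega>} \<omega> * V i \<omega>)"
    proof (rule sum.cong[OF refl])
      fix i assume "i \<in> {..n'}"
      then have "i \<le> nat \<lfloor>\<tau> \<omega>\<rfloor>" by (simp add: n'_def n_def)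
      then have "real i \<le> \<tau> \<omega>" using \<tau>0[OF \<omega>] by linarith
      then show "V i \<omega> = indicator {\<omega>\<in>space M. real i \<le> \<tau> \<omega>} \<omega> * V i \<omega>" using \<omega> by simp
    qed
    also have "\<dots> \<le> W \<omega>" unfolding W_def by (rule sum_le_suminf) auto
    finally show ?thesis .
  qed

  have V_int: "(\<integral>\<^sup>+\<omega>. indicator A \<omega> * V i \<omega> \<partial>M) \<le> emeasure M A * ennreal (b + 2 * (\<mu> + 1))"
    if A: "A \<in> sets (F (real i))" for A i
  proof -
    have AM [measurable]: "A \<in> sets M" using A sets_F_subset[of "real i"] by simp
    let ?p = "\<lambda>m. emeasure M {\<omega>\<in>space M. norm (Z 1 \<omega>) > real m}"
    have "(\<integral>\<^sup>+\<omega>. indicator A \<omega> * V i \<omega> \<partial>M) =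
      (\<integral>\<^sup>+\<omega>. ennreal b * indicator A \<omega> + (\<Sum>m. indicator (A \<inter> osc (real i) 1 (real m + b)) \<omega>) \<partial>M)"
      unfolding V_def
      by (intro nn_integral_cong) (auto simp: indicator_def distrib_left)
    also have "\<dots> = ennreal b * emeasure M A + (\<Sum>m. emeasure M (A \<inter> osc (real i) 1 (real m + b)))"
      by (simp add: nn_integral_add nn_integral_cmult nn_integral_suminf)
    also have "\<dots> \<le> ennreal b * emeasure M A + (\<Sum>m. 2 * emeasure M A * ?p m)"
    proof (intro add_left_mono suminf_le)
      fix m :: nat
      have "prob (A \<inter> osc (real i) 1 (real m + b)) \<le> 2 * prob A * prob {\<omega>\<in>space M. norm (Z 1 \<omega>) > real m}"
        by (rule ottaviani_osc) (use A half in auto)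
      then have "ennreal (prob (A \<inter> osc (real i) 1 (real m + b))) \<le>
          ennreal (2 * prob A * prob {\<omega>\<in>space M. norm (Z 1 \<omega>) > real m})" by (rule ennreal_leI)
      then show "emeasure M (A \<inter> osc (real i) 1 (real m + b)) \<le> 2 * emeasure M A * ?p m"
        by (simp add: emeasure_eq_measure ennreal_mult)
    qed auto
    also have "(\<Sum>m. 2 * emeasure M A * ?p m) = 2 * emeasure M A * (\<Sum>m. ?p m)"
      by (rule ennreal_suminf_cmult)
    also have "(\<Sum>m. ?p m) \<le> ennreal (\<mu> + 1)"
    proof -
      have "(\<Sum>m. ?p m) = (\<Sum>m. \<integral>\<^sup>+\<omega>. indicator {\<omega>\<in>space M. norm (Z 1 \<omega>) > real m} \<omega> \<partial>M)"
        by (simp add: nn_integral_indicator)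
      also have "\<dots> = (\<integral>\<^sup>+\<omega>. (\<Sum>m. indicator {\<omega>\<in>space M. norm (Z 1 \<omega>) > real m} \<omega>) \<partial>M)"
        by (rule nn_integral_suminf[symmetric]) measurable
      also have "\<dots> \<le> (\<integral>\<^sup>+\<omega>. ennreal (norm (Z 1 \<omega>) + 1) \<partial>M)"
      proof (rule nn_integral_mono)
        fix \<omega>
        have "(\<Sum>m. indicator {\<omega>\<in>space M. norm (Z 1 \<omega>) > real m} \<omega> :: ennreal) \<le>
            (\<Sum>m. if real m \<le> norm (Z 1 \<omega>) then 1 else 0)"
          by (intro suminf_le) (auto simp: indicator_def)
        also have "\<dots> \<le> ennreal (norm (Z 1 \<omega>) + 1)" by (rule suminf_indicator_le) simp
        finally show "(\<Sum>m. indicator {\<omega>\<in>space M. norm (Z 1 \<omega>) > real m} \<omega>) \<le> ennreal (norm (Z 1 \<omega>) + 1)" .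
      qed
      also have "\<dots> = ennreal (\<integral>\<omega>. norm (Z 1 \<omega>) + 1 \<partial>M)"
        by (rule nn_integral_eq_integral) (use Z(1)[of 1] in auto)
      also have "\<dots> = ennreal (\<mu> + 1)" using Z(1)[of 1] by (simp add: \<mu>_def prob_space)
      finally show ?thesis .
    qed
    then have "ennreal b * emeasure M A + 2 * emeasure M A * (\<Sum>m. ?p m) \<le>
      ennreal b * emeasure M A + 2 * emeasure M A * ennreal (\<mu> + 1)"
      by (intro add_left_mono mult_left_mono) auto
    also have "\<dots> = emeasure M A * ennreal (b + 2 * (\<mu> + 1))"
    proof -
      have "ennreal (b + 2 * (\<mu> + 1)) = ennreal b + 2 * ennreal (\<mu> + 1)"
        using b \<mu>0 by (subst ennreal_plus) (auto simp: ennreal_mult)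
      then show ?thesis by (simp add: distrib_left mult_ac)
    qed
    finally show ?thesis .
  qed
  have "{\<omega>\<in>space M. real i \<le> \<tau> \<omega>} \<in> sets (F (real i))" for i
  proof (cases "i = 0")
    case True
    then have "{\<omega>\<in>space M. real i \<le> \<tau> \<omega>} = space (F (real i))" using \<tau>0 by auto
    then show ?thesis using sets.top[of "F (real i)"] by simp
  next
    case False
    have "{\<omega>\<in>space M. real i \<le> \<tau> \<omega>} = space (F (real i)) - {\<omega>\<in>space M. \<tau> \<omega> < real i}" by auto
    also have "\<dots> \<in> sets (F (real i))"
      by (rule sets.compl_sets) (use \<tau>(1) False in \<open>auto simp: optional_time_def\<close>)
    finally show ?thesis .
  qed
  note V_int' = V_int[OF this]
  have "(\<integral>\<^sup>+\<omega>. W \<omega> \<partial>M) = (\<Sum>i. \<integral>\<^sup>+\<omega>. indicator {\<omega>\<in>space M. real i \<le> \<tau> \<omega>} \<omega> * V i \<omega> \<partial>M)"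
    unfolding W_def by (rule nn_integral_suminf) measurable
  also have "\<dots> \<le> (\<Sum>i. emeasure M {\<omega>\<in>space M. real i \<le> \<tau> \<omega>} * ennreal (b + 2 * (\<mu> + 1)))"
    by (intro suminf_le V_int') auto
  also have "\<dots> = (\<Sum>i. emeasure M {\<omega>\<in>space M. real i \<le> \<tau> \<omega>}) * ennreal (b + 2 * (\<mu> + 1))"
    by (rule ennreal_suminf_multc)
  also have "(\<Sum>i. emeasure M {\<omega>\<in>space M. real i \<le> \<tau> \<omega>}) \<le> ennreal (\<integral>\<omega>. \<tau> \<omega> + 1 \<partial>M)"
  proof -
    have "(\<Sum>i. emeasure M {\<omega>\<in>space M. real i \<le> \<tau> \<omega>}) =
        (\<Sum>i. \<integral>\<^sup>+\<omega>. indicator {\<omega>\<in>space M. real i \<le> \<tau> \<omega>} \<omega> \<partial>M)"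
      by (simp add: nn_integral_indicator)
    also have "\<dots> = (\<integral>\<^sup>+\<omega>. (\<Sum>i. indicator {\<omega>\<in>space M. real i \<le> \<tau> \<omega>} \<omega>) \<partial>M)"
      by (rule nn_integral_suminf[symmetric]) measurable
    also have "\<dots> \<le> (\<integral>\<^sup>+\<omega>. ennreal (\<tau> \<omega> + 1) \<partial>M)"
    proof (rule nn_integral_mono)
      fix \<omega> assume \<omega>: "\<omega> \<in> space M"
      have "(\<Sum>i. indicator {\<omega>\<in>space M. real i \<le> \<tau> \<omega>} \<omega> :: ennreal) = (\<Sum>i. if real i \<le> \<tau> \<omega> then 1 else 0)"
        using \<omega> by (intro suminf_cong) (simp add: indicator_def)
      also have "\<dots> \<le> ennreal (\<tau> \<omega> + 1)" by (rule suminf_indicator_le[OF \<tau>0[OF \<omega>]])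
      finally show "(\<Sum>i. indicator {\<omega>\<in>space M. real i \<le> \<tau> \<omega>} \<omega>) \<le> ennreal (\<tau> \<omega> + 1)" .
    qed
    also have "\<dots> = ennreal (\<integral>\<omega>. \<tau> \<omega> + 1 \<partial>M)"
      by (rule nn_integral_eq_integral) (use \<tau>(2) \<tau>0 in \<open>auto intro!: AE_I2\<close>)
    finally show ?thesis .
  qed
  then have "(\<Sum>i. emeasure M {\<omega>\<in>space M. real i \<le> \<tau> \<omega>}) * ennreal (b + 2 * (\<mu> + 1)) \<le>
      ennreal (\<integral>\<omega>. \<tau> \<omega> + 1 \<partial>M) * ennreal (b + 2 * (\<mu> + 1))"
    by (rule mult_right_mono) simp
  also have "\<dots> < \<infinity>" by (simp add: ennreal_mult_less_top)
  finally have W_fin: "(\<integral>\<^sup>+\<omega>. W \<omega> \<partial>M) < \<infinity>" .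

  have W_ae: "AE \<omega> in M. W \<omega> < \<infinity>"
    using nn_integral_noteq_infinite[of W M] W_fin by (auto simp: less_top)
  have Wi: "integrable M (\<lambda>\<omega>. enn2real (W \<omega>))"
  proof (rule integrableI_nonneg)
    have "(\<integral>\<^sup>+\<omega>. ennreal (enn2real (W \<omega>)) \<partial>M) \<le> (\<integral>\<^sup>+\<omega>. W \<omega> \<partial>M)"
      by (intro nn_integral_mono) (simp add: ennreal_enn2real_if)
    then show "(\<integral>\<^sup>+\<omega>. ennreal (enn2real (W \<omega>)) \<partial>M) < \<infinity>" using W_fin by (rule le_less_trans)
  qed auto
  have [measurable]: "(\<lambda>\<omega>. Z (T k \<omega>) \<omega>) \<in> borel_measurable M" "(\<lambda>\<omega>. Z (\<tau> \<omega>) \<omega>) \<in> borel_measurable M" for k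
    using Z_approx_time_measurable[OF \<tau>(1)] Z_optional_time_measurable[OF \<tau>(1)] by (auto simp: T_def)
  have lim: "AE \<omega> in M. (\<lambda>k. Z (T k \<omega>) \<omega>) \<longlonglongrightarrow> Z (\<tau> \<omega>) \<omega>"
    using approx_time_tendsto(2)[OF \<tau>(1)] by (auto simp: T_def)
  have bnd: "AE \<omega> in M. norm (Z (T k \<omega>) \<omega>) \<le> enn2real (W \<omega>)" for k
    using W_ae AE_space
  proof eventually_elim
    case (elim \<omega>)
    then show ?case using enn2real_mono[OF T_le_W[of \<omega> k]] by simp
  qed
  show "integrable M (\<lambda>\<omega>. Z (\<tau> \<omega>) \<omega>)"
    by (rule integrable_dominated_convergence[OF _ _ Wi lim bnd]) auto
  have "(\<lambda>k. \<integral>\<omega>. Z (T k \<omega>) \<omega> \<partial>M) \<longlonglongrightarrow> (\<integral>\<omega>. Z (\<tau> \<omega>) \<omega> \<partial>M)"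
    by (rule integral_dominated_convergence[OF _ _ Wi lim bnd]) auto
  moreover have Z_T: "(\<integral>\<omega>. Z (T k \<omega>) \<omega> \<partial>M) = 0" for k
    unfolding T_def approx_time_def
    by (rule wald_grid_mean[of k "\<lambda>\<omega>. dyadic_time k (\<tau> \<omega>)" "k * 2 ^ k"])
      (use grid_time_dyadic[OF \<tau>(1) order_refl[of k]] Z in \<open>auto simp: dyadic_time_def\<close>)
  ultimately show "(\<integral>\<omega>. Z (\<tau> \<omega>) \<omega> \<partial>M) = 0"
    unfolding Z_T by (simp add: LIMSEQ_const_iff)
qed

end

section \<open>The augmented natural filtration of a Levy process\<close>

text \<open>The events of \<open>M\<close> that agree almost surely with an event of a sub-sigma-algebra.\<close>

lemma sigma_algebra_augment:
  fixes M :: "'w measure"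
  assumes "sigma_algebra (space M) \<A>"
  shows "sigma_algebra (space M) {A \<in> sets M. \<exists>B\<in>\<A>. AE \<omega> in M. \<omega> \<in> A \<longleftrightarrow> \<omega> \<in> B}" (is "sigma_algebra _ ?P")
proof -
  interpret sigma_algebra "space M" \<A> by fact
  show ?thesis
    unfolding sigma_algebra_iff2
  proof (intro conjI ballI allI impI)
    show "?P \<subseteq> Pow (space M)" using sets.sets_into_space by auto
    show "{} \<in> ?P" by (auto intro!: bexI[of _ "{}"])
    show "space M - A \<in> ?P" if "A \<in> ?P" for A
    proof -
      from that obtain B where B: "A \<in> sets M" "B \<in> \<A>" "AE \<omega> in M. \<omega> \<in> A \<longleftrightarrow> \<omega> \<in> B" by auto
      have "AE \<omega> in M. \<omega> \<in> space M - A \<longleftrightarrow> \<omega> \<in> space M - B" using B(3) by eventually_elim auto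
      then show ?thesis using B(1,2) compl_sets[of B] by blast
    qed
    show "(\<Union>i. A i) \<in> ?P" if "range A \<subseteq> ?P" for A :: "nat \<Rightarrow> 'w set"
    proof -
      from that have "\<forall>i. \<exists>B. B \<in> \<A> \<and> (AE \<omega> in M. \<omega> \<in> A i \<longleftrightarrow> \<omega> \<in> B)" by auto
      from choice[OF this] obtain B where B: "\<And>i. B i \<in> \<A>" "\<And>i. AE \<omega> in M. \<omega> \<in> A i \<longleftrightarrow> \<omega> \<in> B i"
        by blast
      have "AE \<omega> in M. \<forall>i. \<omega> \<in> A i \<longleftrightarrow> \<omega> \<in> B i" unfolding AE_all_countable using B(2) by blast
      then have "AE \<omega> in M. \<omega> \<in> (\<Union>i. A i) \<longleftrightarrow> \<omega> \<in> (\<Union>i. B i)" by eventually_elim auto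
      moreover have "(\<Union>i. B i) \<in> \<A>" using B(1) by (intro countable_UN) auto
      moreover have "(\<Union>i. A i) \<in> sets M" using that by (intro sets.countable_UN) auto
      ultimately show ?thesis by blast
    qed
  qed
qed

context levy_process
begin

text \<open>
  The process started exactly, and not only almost surely, at 0. It has the same increments as \<open>X\<close>.
\<close>

definition W :: "real \<Rightarrow> 'w \<Rightarrow> 'a" where
  "W t \<omega> = X t \<omega> - X 0 \<omega>"

text \<open>
  Events determined by finitely many positions up to time \<open>t\<close>: an intersection-stable generator of
  the natural filtration.
\<close>

definition cylinders :: "real \<Rightarrow> 'w set set" where
  "cylinders t = {{\<omega>\<in>space M. \<forall>u\<in>T. W u \<omega> \<in> B u} | T B. finite T \<and> T \<subseteq> {0..t} \<and> (\<forall>u. B u \<in> sets borel)}"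

text \<open>The natural filtration of \<open>W\<close>, augmented by null sets.\<close>

definition past :: "real \<Rightarrow> 'w measure" where
  "past t = sigma (space M) {A \<in> sets M. \<exists>B\<in>sigma_sets (space M) (cylinders t). AE \<omega> in M. \<omega> \<in> A \<longleftrightarrow> \<omega> \<in> B}"

lemma W_measurable [measurable]: "0 \<le> t \<Longrightarrow> W t \<in> borel_measurable M"
  unfolding W_def[abs_def] using random_variables[of t] random_variables[of 0] by simp

lemma cylinders_sets: "A \<in> cylinders t \<Longrightarrow> A \<in> sets M"
proof -
  assume "A \<in> cylinders t"
  then obtain T B where A: "A = {\<omega>\<in>space M. \<forall>u\<in>T. W u \<omega> \<in> B u}" "finite T" "T \<subseteq> {0..t}" "\<And>u. B u \<in> sets borel"
    by (auto simp: cylinders_def)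
  have "{\<omega>\<in>space M. W u \<omega> \<in> B u} \<in> sets M" if "u \<in> T" for u
    using measurable_sets[OF W_measurable A(4)[of u], of u] A(3) that
    by (auto simp: vimage_def Int_def conj_commute)
  then show ?thesis unfolding A(1) using A(2) by (rule sets.sets_Collect_finite_All)
qed

lemma cylinders_Int_stable: "Int_stable (cylinders t)"
  unfolding Int_stable_def
proof (intro ballI)
  fix A A' assume "A \<in> cylinders t" "A' \<in> cylinders t"
  then obtain T B T' B' where
    A: "A = {\<omega>\<in>space M. \<forall>u\<in>T. W u \<omega> \<in> B u}" "finite T" "T \<subseteq> {0..t}" "\<And>u. B u \<in> sets borel" and
    A': "A' = {\<omega>\<in>space M. \<forall>u\<in>T'. W u \<omega> \<in> B' u}" "finite T'" "T' \<subseteq> {0..t}" "\<And>u. B' u \<in> sets borel"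
    unfolding cylinders_def by blast
  define C where "C u = (if u \<in> T then B u else UNIV) \<inter> (if u \<in> T' then B' u else UNIV)" for u
  have "A \<inter> A' = {\<omega>\<in>space M. \<forall>u\<in>T \<union> T'. W u \<omega> \<in> C u}" unfolding A A' C_def by auto
  moreover have "finite (T \<union> T')" "T \<union> T' \<subseteq> {0..t}" "\<And>u. C u \<in> sets borel"
    using A A' by (auto simp: C_def)
  ultimately show "A \<inter> A' \<in> cylinders t" unfolding cylinders_def by blast
qed

lemma space_past [simp]: "space (past t) = space M"
  unfolding past_def by (rule space_measure_of) (use sets.sets_into_space in auto)

lemma sets_past:
  "sets (past t) = {A \<in> sets M. \<exists>B\<in>sigma_sets (space M) (cylinders t). AE \<omega> in M. \<omega> \<in> A \<longleftrightarrow> \<omega> \<in> B}"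
proof -
  have "sigma_algebra (space M) (sigma_sets (space M) (cylinders t))"
    by (rule sigma_algebra_sigma_sets) (use sets.sets_into_space[OF cylinders_sets] in blast)
  then show ?thesis
    unfolding past_def by (intro sigma_algebra.sets_measure_of_eq sigma_algebra_augment)
qed

lemma sigma_cylinders_subset: "sigma_sets (space M) (cylinders t) \<subseteq> sets M"
  by (rule sets.sigma_sets_subset) (use cylinders_sets in auto)

text \<open>
  The times of a cylinder event, together with 0 and \<open>s\<close>, are sorted into the list \<open>L\<close>. The positions
  at these times are partial sums of the increments along \<open>L\<close>, hence a function of the increments before
  the last one, which is \<open>W t - W s\<close>.
\<close>

lemma cylinder_indep:
  assumes st: "0 \<le> s" "s \<le> t" and A: "A \<in> cylinders s" and C: "C \<in> sets borel"
  shows "prob (A \<inter> {\<omega>\<in>space M. W t \<omega> - W s \<omega> \<in> C}) = prob A * prob {\<omega>\<in>space M. W t \<omega> - W s \<omega> \<in> C}"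
proof -
  from A obtain T B where A: "A = {\<omega>\<in>space M. \<forall>u\<in>T. W u \<omega> \<in> B u}" "finite T" "T \<subseteq> {0..s}"
    "\<And>u. B u \<in> sets borel"
    by (auto simp: cylinders_def)
  define L where "L = sorted_list_of_set (insert 0 (insert s T))"
  define n where "n = length L"
  have "finite (insert 0 (insert s T))" using A(2) by simp
  then have L: "set L = insert 0 (insert s T)" "sorted L"
    unfolding L_def by (rule set_sorted_list_of_set) simp
  have L_ge: "0 \<le> L ! i" "L ! i \<le> s" if "i < n" for i
    using nth_mem[of i L] that L A(3) st by (auto simp: n_def)
  have n0: "0 < n" using L(1) by (auto simp: n_def)
  have L0: "L ! 0 = 0"
  proof -
    obtain i where "i < n" "L ! i = 0" using L(1) by (metis in_set_conv_nth insertI1 n_def)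
    then show ?thesis using sorted_nth_mono[OF L(2), of 0 i] L_ge(1)[OF n0] by (simp add: n_def)
  qed
  have Ln: "L ! (n - 1) = s"
  proof -
    obtain i where "i < n" "L ! i = s" using L(1) by (metis in_set_conv_nth insertI1 insertI2 n_def)
    then show ?thesis using sorted_nth_mono[OF L(2), of i "n - 1"] L_ge(2)[of "n - 1"] n0
      by (simp add: n_def)
  qed
  define r where "r i = (if i < n then L ! i else t)" for i
  have r_mono: "mono r"
  proof (rule monoI)
    fix i j :: nat assume "i \<le> j"
    then show "r i \<le> r j"
      using sorted_nth_mono[OF L(2), of i j] L_ge(2)[of i] st by (auto simp: r_def n_def)
  qed
  define \<xi> where "\<xi> i \<omega> = X (r (Suc i)) \<omega> - X (r i) \<omega>" for i \<omega>
  have ind: "indep_vars (\<lambda>_. borel) \<xi> {..<n}"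
    unfolding \<xi>_def[abs_def] using independent_increments[OF _ r_mono, of n] n0 L0 by (simp add: r_def)
  have W_sum: "W (L ! k) \<omega> = (\<Sum>i<k. \<xi> i \<omega>)" if "k < n" for k \<omega>
    using that sum_lessThan_telescope[of "\<lambda>i. X (r i) \<omega>" k] n0 L0 by (simp add: \<xi>_def W_def r_def)
  have last: "\<xi> (n - 1) \<omega> = W t \<omega> - W s \<omega>" for \<omega>
    using n0 Ln by (simp add: \<xi>_def r_def W_def)
  have "\<exists>k. k < n \<and> L ! k = u" if "u \<in> T" for u
    using that L(1) by (metis in_set_conv_nth insertI2 n_def)
  then obtain idx where idx: "\<And>u. u \<in> T \<Longrightarrow> idx u < n" "\<And>u. u \<in> T \<Longrightarrow> L ! idx u = u"
    by metis
  let ?I = "{..<n - 1}" and ?J = "{n - 1}"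
  let ?P = "PiM ?I (\<lambda>_. borel :: 'a measure)" and ?Q = "PiM ?J (\<lambda>_. borel :: 'a measure)"
  have iv: "indep_var ?P (\<lambda>\<omega>. restrict (\<lambda>i. \<xi> i \<omega>) ?I) ?Q (\<lambda>\<omega>. restrict (\<lambda>i. \<xi> i \<omega>) ?J)"
    by (rule indep_var_restrict[OF ind]) (use n0 in auto)
  define U where "U = {x\<in>space ?P. \<forall>u\<in>T. (\<Sum>i<idx u. x i) \<in> B u}"
  define V where "V = {x\<in>space ?Q. x (n - 1) \<in> C}"
  have U: "U \<in> sets ?P"
    unfolding U_def
  proof (rule sets.sets_Collect_finite_All[OF _ A(2)])
    fix u assume u: "u \<in> T"
    have "(\<lambda>x. \<Sum>i<idx u. x i) \<in> borel_measurable ?P"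
      by (intro borel_measurable_sum measurable_component_singleton) (use idx(1)[OF u] in auto)
    from measurable_sets[OF this A(4)[of u]]
    show "{x\<in>space ?P. (\<Sum>i<idx u. x i) \<in> B u} \<in> sets ?P" by (simp add: vimage_def Int_def conj_commute)
  qed
  have V: "V \<in> sets ?Q"
    using measurable_sets[OF measurable_component_singleton[of "n - 1" ?J "\<lambda>_. borel"] C]
    by (simp add: V_def vimage_def Int_def conj_commute)
  have sp: "restrict (\<lambda>i. \<xi> i \<omega>) K \<in> space (PiM K (\<lambda>_. borel :: 'a measure))" for K \<omega>
    by (simp add: space_PiM)
  have eA: "(\<lambda>\<omega>. restrict (\<lambda>i. \<xi> i \<omega>) ?I) -` U \<inter> space M = A"
  proof -
    have "(\<Sum>i<idx u. restrict (\<lambda>i. \<xi> i \<omega>) ?I i) = W u \<omega>" if u: "u \<in> T" for u \<omega>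
      using W_sum[OF idx(1)[OF u], of \<omega>] idx[OF u] by (auto intro!: sum.cong)
    then show ?thesis using sp unfolding U_def A(1) by auto
  qed
  have eC: "(\<lambda>\<omega>. restrict (\<lambda>i. \<xi> i \<omega>) ?J) -` V \<inter> space M = {\<omega>\<in>space M. W t \<omega> - W s \<omega> \<in> C}"
    using sp last unfolding V_def by auto
  have "(\<lambda>\<omega>. (restrict (\<lambda>i. \<xi> i \<omega>) ?I, restrict (\<lambda>i. \<xi> i \<omega>) ?J)) -` (U \<times> V) \<inter> space M =
    A \<inter> {\<omega>\<in>space M. W t \<omega> - W s \<omega> \<in> C}"
    unfolding eA[symmetric] eC[symmetric] by auto
  with indep_varD[OF iv U V] show ?thesis unfolding eA eC by simp
qed

lemma past_indep:
  assumes st: "0 \<le> s" "s \<le> t" and A: "A \<in> sets (past s)" and C: "C \<in> sets borel"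
  shows "prob (A \<inter> {\<omega>\<in>space M. W t \<omega> - W s \<omega> \<in> C}) = prob A * prob {\<omega>\<in>space M. W t \<omega> - W s \<omega> \<in> C}"
proof -
  let ?V = "{\<omega>\<in>space M. W t \<omega> - W s \<omega> \<in> C}"
  have [measurable]: "W t \<in> borel_measurable M" "W s \<in> borel_measurable M" using st by auto
  have V [measurable]: "?V \<in> sets M" using C by measurable
  obtain B where B: "A \<in> sets M" "B \<in> sigma_sets (space M) (cylinders s)" "AE \<omega> in M. \<omega> \<in> A \<longleftrightarrow> \<omega> \<in> B"
    using A by (auto simp: sets_past)
  have BM: "B \<in> sets M" using B(2) sigma_cylinders_subset by auto
  have "indep_set (cylinders s) {?V}"
    by (rule indep_setI) (use cylinders_sets V cylinder_indep[OF st _ C] in auto)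
  then have "indep_set (sigma_sets (space M) (cylinders s)) (sigma_sets (space M) {?V})"
    by (rule indep_set_sigma_sets[OF _ cylinders_Int_stable]) (simp add: Int_stable_def)
  then have "prob (B \<inter> ?V) = prob B * prob ?V" by (rule indep_setD[OF _ B(2)]) auto
  moreover have "prob (A \<inter> ?V) = prob (B \<inter> ?V)"
    by (rule finite_measure_eq_AE) (use B BM in auto)
  moreover have "prob A = prob B"
    by (rule finite_measure_eq_AE) (use B BM in auto)
  ultimately show ?thesis by simp
qed

lemma adapted_increments_W: "adapted_increments M past W"
proof unfold_locales
  show "subalgebra M (past t)" for t by (auto simp: subalgebra_def sets_past)
  show "sets (past s) \<subseteq> sets (past t)" if "s \<le> t" for s t
  proof -
    have "{0..s} \<subseteq> {0..t}" using that by simp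
    then have "cylinders s \<subseteq> cylinders t" unfolding cylinders_def by (blast intro: order_trans)
    then have "sigma_sets (space M) (cylinders s) \<subseteq> sigma_sets (space M) (cylinders t)"
      by (rule sigma_sets_mono')
    then show ?thesis by (auto simp: sets_past)
  qed
  show "A \<in> sets (past t)" if A: "A \<in> sets M" "B \<in> sets (past t)" "AE \<omega> in M. \<omega> \<in> A \<longleftrightarrow> \<omega> \<in> B" for t A B
  proof -
    from A(2) obtain B' where B': "B' \<in> sigma_sets (space M) (cylinders t)" "AE \<omega> in M. \<omega> \<in> B \<longleftrightarrow> \<omega> \<in> B'"
      by (auto simp: sets_past)
    have "AE \<omega> in M. \<omega> \<in> A \<longleftrightarrow> \<omega> \<in> B'" using A(3) B'(2) by eventually_elim auto
    then show ?thesis using A(1) B'(1) by (auto simp: sets_past)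
  qed
  show "W t \<in> borel_measurable (past t)" if t: "0 \<le> t" for t
  proof (rule measurableI)
    fix C :: "'a set" assume C: "C \<in> sets borel"
    have "{\<omega>\<in>space M. \<forall>u\<in>{t}. W u \<omega> \<in> C} \<in> cylinders t"
      unfolding cylinders_def using t C by (intro CollectI exI[of _ "{t}"] exI[of _ "\<lambda>_. C"]) auto
    moreover have "{\<omega>\<in>space M. \<forall>u\<in>{t}. W u \<omega> \<in> C} = W t -` C \<inter> space (past t)" by auto
    ultimately have *: "W t -` C \<inter> space (past t) \<in> sigma_sets (space M) (cylinders t)" by auto
    then have "W t -` C \<inter> space (past t) \<in> sets M" using sigma_cylinders_subset by auto
    with * show "W t -` C \<inter> space (past t) \<in> sets (past t)" unfolding sets_past by blast
  qed simp
  show "prob (A \<inter> {\<omega>\<in>space M. W t \<omega> - W s \<omega> \<in> C}) = prob A * prob {\<omega>\<in>space M. W t \<omega> - W s \<omega> \<in> C}"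
    if "0 \<le> s" "s \<le> t" "A \<in> sets (past s)" "C \<in> sets borel" for s t A C
    using past_indep that by blast
  show "distr M borel (\<lambda>\<omega>. W (s + h) \<omega> - W s \<omega>) = distr M borel (W h)" if "0 \<le> s" "0 \<le> h" for s h
    using stationary_increments[OF that] by (simp add: W_def[abs_def])
  show "W 0 \<omega> = 0" for \<omega> by (simp add: W_def)
  show "((\<lambda>u. W u \<omega>) \<longlongrightarrow> W t \<omega>) (at_right t)" if "\<omega> \<in> space M" "0 \<le> t" for \<omega> t
    using cadlag_paths[OF that(1)] that(2) unfolding W_def by (intro tendsto_diff tendsto_const) (auto simp: cadlag_def)
qed

end

section \<open>Centring\<close>

context adapted_increments
begin

lemma subtract_drift:
  assumes add: "\<And>s h. 0 \<le> s \<Longrightarrow> 0 \<le> h \<Longrightarrow> m (s + h) = m s + m h"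
    and rc: "\<And>t. 0 \<le> t \<Longrightarrow> (m \<longlongrightarrow> m t) (at_right t)"
  shows "adapted_increments M F (\<lambda>t \<omega>. Z t \<omega> - m t)"
proof unfold_locales
  have m0: "m 0 = 0" using add[of 0 0] by simp
  show "subalgebra M (F t)" if "0 \<le> t" for t using subalg that .
  show "sets (F s) \<subseteq> sets (F t)" if "0 \<le> s" "s \<le> t" for s t using F_mono that .
  show "A \<in> sets (F t)" if "0 \<le> t" "A \<in> sets M" "B \<in> sets (F t)" "AE \<omega> in M. \<omega> \<in> A \<longleftrightarrow> \<omega> \<in> B" for t A B
    using F_complete that .
  show "(\<lambda>\<omega>. Z t \<omega> - m t) \<in> borel_measurable (F t)" if "0 \<le> t" for t
    using adapted[OF that] by measurable
  show "prob (A \<inter> {\<omega>\<in>space M. (Z t \<omega> - m t) - (Z s \<omega> - m s) \<in> C}) =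
      prob A * prob {\<omega>\<in>space M. (Z t \<omega> - m t) - (Z s \<omega> - m s) \<in> C}"
    if "0 \<le> s" "s \<le> t" "A \<in> sets (F s)" "C \<in> sets borel" for s t A C
  proof -
    define C' where "C' = (\<lambda>x. x - (m t - m s)) -` C"
    have "C' \<in> sets borel"
      using measurable_sets[of "\<lambda>x. x - (m t - m s)" borel borel C] that(4) by (simp add: C'_def)
    moreover have "(Z t \<omega> - m t) - (Z s \<omega> - m s) \<in> C \<longleftrightarrow> Z t \<omega> - Z s \<omega> \<in> C'" for \<omega>
      by (simp add: C'_def algebra_simps)
    ultimately show ?thesis using indep_past[OF that(1-3), of C'] by simp
  qed
  show "distr M borel (\<lambda>\<omega>. (Z (s + h) \<omega> - m (s + h)) - (Z s \<omega> - m s)) = distr M borel (\<lambda>\<omega>. Z h \<omega> - m h)"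
    if sh: "0 \<le> s" "0 \<le> h" for s h
  proof -
    have [measurable]: "Z s \<in> borel_measurable M" "Z (s + h) \<in> borel_measurable M" "Z h \<in> borel_measurable M"
      using sh by auto
    have eq: "(Z (s + h) \<omega> - m (s + h)) - (Z s \<omega> - m s) = (Z (s + h) \<omega> - Z s \<omega>) - m h" for \<omega>
      by (simp add: add[OF sh])
    have "distr M borel (\<lambda>\<omega>. (Z (s + h) \<omega> - m (s + h)) - (Z s \<omega> - m s)) =
        distr (distr M borel (\<lambda>\<omega>. Z (s + h) \<omega> - Z s \<omega>)) borel (\<lambda>x. x - m h)"
      unfolding eq by (subst distr_distr) (simp_all add: comp_def)
    also have "\<dots> = distr M borel (\<lambda>\<omega>. Z h \<omega> - m h)"
      unfolding stationary[OF sh] by (subst distr_distr) (auto simp: comp_def)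
    finally show ?thesis .
  qed
  show "Z 0 \<omega> - m 0 = 0" if "\<omega> \<in> space M" for \<omega> using start_0[OF that] m0 by simp
  show "((\<lambda>u. Z u \<omega> - m u) \<longlongrightarrow> Z t \<omega> - m t) (at_right t)" if "\<omega> \<in> space M" "0 \<le> t" for \<omega> t
    using right_cont[OF that] rc[OF that(2)] by (rule tendsto_diff)
qed

text \<open>
  An additive function \<open>m\<close> need not be linear, but it is right-continuous if \<open>Z t - m t\<close> has second
  moment \<open>C t\<close>: for small times both \<open>Z t\<close> and \<open>Z t - m t\<close> are small with high probability, hence so
  is their deterministic difference.
\<close>

lemma mean_right_continuous:
  assumes add: "\<And>s h. 0 \<le> s \<Longrightarrow> 0 \<le> h \<Longrightarrow> m (s + h) = m s + m h"
    and sq: "\<And>t. 0 \<le> t \<Longrightarrow> integrable M (\<lambda>\<omega>. (norm (Z t \<omega> - m t))\<^sup>2)"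
      "\<And>t. 0 \<le> t \<Longrightarrow> (\<integral>\<omega>. (norm (Z t \<omega> - m t))\<^sup>2 \<partial>M) = C * t"
    and t: "0 \<le> t"
  shows "(m \<longlongrightarrow> m t) (at_right t)"
proof -
  have C0: "0 \<le> C"
  proof -
    have "0 \<le> (\<integral>\<omega>. (norm (Z 1 \<omega> - m 1))\<^sup>2 \<partial>M)" by simp
    then show ?thesis using sq(2)[of 1] by simp
  qed
  have "\<exists>d>0. \<forall>h. 0 \<le> h \<and> h \<le> d \<longrightarrow> norm (m h) < e" if e: "0 < e" for e
  proof -
    obtain d where d: "0 < d" "\<And>v. 0 \<le> v \<Longrightarrow> v \<le> d \<Longrightarrow> prob {\<omega>\<in>space M. norm (Z v \<omega>) > e / 2} \<le> 1 / 4"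
      using stochastic_continuity[of "e / 2" "1 / 4"] e by auto
    define d' where "d' = min d (e\<^sup>2 / (16 * (C + 1)))"
    have "norm (m h) < e" if h: "0 \<le> h" "h \<le> d'" for h
    proof -
      have [measurable]: "Z h \<in> borel_measurable M" using h by simp
      let ?A = "{\<omega>\<in>space M. norm (Z h \<omega>) > e / 2}" and ?B = "{\<omega>\<in>space M. (norm (Z h \<omega> - m h))\<^sup>2 \<ge> (e / 2)\<^sup>2}"
      have "prob ?B \<le> (\<integral>\<omega>. (norm (Z h \<omega> - m h))\<^sup>2 \<partial>M) / (e / 2)\<^sup>2"
        by (rule integral_Markov_inequality_measure[where A = "{}"]) (use sq h e in auto)
      also have "\<dots> = C * h * 4 / e\<^sup>2" using sq(2)[OF h(1)] by (simp add: power_divide)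
      also have "\<dots> \<le> 1 / 4"
      proof -
        have "h \<le> e\<^sup>2 / (16 * (C + 1))" using h by (simp add: d'_def)
        then have "C * h \<le> C * (e\<^sup>2 / (16 * (C + 1)))" using C0 by (intro mult_left_mono)
        also have "\<dots> \<le> e\<^sup>2 / 16" using C0 by (simp add: field_simps)
        finally show ?thesis using e by (simp add: field_simps)
      qed
      finally have B: "prob ?B \<le> 1 / 4" .
      have A: "prob ?A \<le> 1 / 4" using d h by (simp add: d'_def)
      have "prob (?A \<union> ?B) \<le> prob ?A + prob ?B" by (rule measure_Un_le) measurable
      then have "prob (?A \<union> ?B) < prob (space M)" using A B by (simp add: prob_space)
      then have "?A \<union> ?B \<noteq> space M" by force
      then obtain \<omega> where \<omega>: "\<omega> \<in> space M" "\<omega> \<notin> ?A \<union> ?B" by blast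
      then have "norm (Z h \<omega>) \<le> e / 2" "(norm (Z h \<omega> - m h))\<^sup>2 < (e / 2)\<^sup>2"
        by (auto simp: not_less not_le)
      moreover from this(2) have "norm (Z h \<omega> - m h) < e / 2"
        by (rule power2_less_imp_less) (use e in simp)
      ultimately show ?thesis using norm_triangle_ineq4[of "Z h \<omega>" "Z h \<omega> - m h"] by simp
    qed
    moreover have "0 < d'" using d e C0 by (simp add: d'_def)
    ultimately show ?thesis by blast
  qed
  note small = this
  show ?thesis
  proof (rule tendstoI)
    fix e :: real assume "0 < e"
    then obtain d where d: "0 < d" "\<And>h. 0 \<le> h \<Longrightarrow> h \<le> d \<Longrightarrow> norm (m h) < e" using small by blast
    have "dist (m u) (m t) < e" if "t < u" "u < t + d" for u
      using add[of t "u - t"] d(2)[of "u - t"] t that by (simp add: dist_norm)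
    then show "eventually (\<lambda>u. dist (m u) (m t) < e) (at_right t)"
      using eventually_at_right[of t "t + 1"] d(1) by (intro iffD2[OF eventually_at_right[of t "t + 1"]]) (auto intro!: exI[of _ "t + d"])
  qed
qed

end

section \<open>The exit time and the exit position\<close>

context levy_process
begin

sublocale W: adapted_increments M past W
  by (rule adapted_increments_W)

lemma W_eq_X_AE: "AE \<omega> in M. \<forall>t. W t \<omega> = X t \<omega>"
  using start_at_0 by eventually_elim (simp add: W_def)

lemma exit_time_W_AE: "AE \<omega> in M. exit_time W D \<omega> = exit_time X D \<omega>"
  using W_eq_X_AE by eventually_elim (simp add: exit_time_def)

lemma W_moments:
  assumes "integrable M (X t)" "0 \<le> t"
  shows "integrable M (W t)" "(\<integral>\<omega>. W t \<omega> \<partial>M) = (\<integral>\<omega>. X t \<omega> \<partial>M)"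
proof -
  have [measurable]: "X t \<in> borel_measurable M" "W t \<in> borel_measurable M"
    using random_variables assms(2) by auto
  have eq: "AE \<omega> in M. W t \<omega> = X t \<omega>" using W_eq_X_AE by eventually_elim simp
  show "integrable M (W t)" using assms integrable_cong_AE[OF _ _ eq] by simp
  show "(\<integral>\<omega>. W t \<omega> \<partial>M) = (\<integral>\<omega>. X t \<omega> \<partial>M)" by (rule integral_cong_AE[OF _ _ eq]) simp_all
qed

lemma mean_additive:
  assumes X: "\<And>t. 0 \<le> t \<Longrightarrow> integrable M (X t)" and "0 \<le> s" "0 \<le> h"
  shows "(\<integral>\<omega>. X (s + h) \<omega> \<partial>M) = (\<integral>\<omega>. X s \<omega> \<partial>M) + (\<integral>\<omega>. X h \<omega> \<partial>M)"
proof -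
  note Wm = W_moments[OF X]
  have sh: "0 \<le> s + h" using assms by simp
  have "(\<integral>\<omega>. W (s + h) \<omega> - W s \<omega> \<partial>M) = (\<integral>\<omega>. W h \<omega> \<partial>M)"
    using W.integral_increment(1)[of s "s + h" "\<lambda>x. x"] assms by simp
  then show ?thesis using Wm[OF sh sh] Wm[of s] Wm[of h] assms by (simp add: algebra_simps)
qed

end

text \<open>A Levy process and an open set from which the exit time is measurable and has finite mean.\<close>

locale levy_exit = levy_process M X for M :: "'w measure" and X :: "real \<Rightarrow> 'w \<Rightarrow> 'a::euclidean_space" +
  fixes D :: "'a set"
  assumes open_D: "open D" and D_not_UNIV: "D \<noteq> UNIV"
    and exit_measurable: "exit_time X D \<in> borel_measurable M"
    and exit_finite_mean: "(\<integral>\<^sup>+\<omega>. exit_time X D \<omega> \<partial>M) < \<infinity>"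
begin

text \<open>The exit time as a real number; it is 0 on the null set of paths that never leave \<open>D\<close>.\<close>

definition \<tau> :: "'w \<Rightarrow> real" where
  "\<tau> \<omega> = enn2real (exit_time X D \<omega>)"

lemma \<tau>_nonneg: "0 \<le> \<tau> \<omega>" by (simp add: \<tau>_def)

lemma \<tau>_AE: "AE \<omega> in M. exit_time X D \<omega> = ennreal (\<tau> \<omega>)"
proof -
  have "AE \<omega> in M. exit_time X D \<omega> \<noteq> \<infinity>"
    by (rule nn_integral_noteq_infinite[OF exit_measurable]) (use exit_finite_mean in auto)
  then show ?thesis by eventually_elim (simp add: \<tau>_def less_top)
qed

lemma \<tau>_measurable [measurable]: "\<tau> \<in> borel_measurable M"
  unfolding \<tau>_def[abs_def] using exit_measurable by measurable

lemma \<tau>_optional: "W.optional_time \<tau>"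
  unfolding W.optional_time_def
proof (intro conjI allI impI ballI)
  show "\<tau> \<in> borel_measurable M" by simp
  show "0 \<le> \<tau> \<omega>" for \<omega> by (rule \<tau>_nonneg)
  show "{\<omega>\<in>space M. \<tau> \<omega> < t} \<in> sets (past t)" if t: "0 < t" for t
  proof -
    obtain B where B: "B \<in> sets (past t)" "AE \<omega> in M. exit_time W D \<omega> < ennreal t \<longleftrightarrow> \<omega> \<in> B"
      using W.exit_time_optional[OF open_D D_not_UNIV t] by blast
    have "AE \<omega> in M. \<omega> \<in> {\<omega>\<in>space M. \<tau> \<omega> < t} \<longleftrightarrow> \<omega> \<in> B"
      using B(2) exit_time_W_AE[of D] \<tau>_AE AE_space
    proof eventually_elim
      case (elim \<omega>)
      have "exit_time W D \<omega> < ennreal t \<longleftrightarrow> \<tau> \<omega> < t"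
        unfolding elim(2,3) using \<tau>_nonneg[of \<omega>] by (simp add: ennreal_less_iff)
      then show ?case using elim by simp
    qed
    moreover have "{\<omega>\<in>space M. \<tau> \<omega> < t} \<in> sets M" by measurable
    ultimately show ?thesis using W.F_complete[OF less_imp_le[OF t] _ B(1)] by blast
  qed
qed

lemma \<tau>_integrable: "integrable M \<tau>"
  and exit_mean: "(\<integral>\<^sup>+\<omega>. exit_time X D \<omega> \<partial>M) = ennreal (\<integral>\<omega>. \<tau> \<omega> \<partial>M)"
proof -
  have eq: "(\<integral>\<^sup>+\<omega>. exit_time X D \<omega> \<partial>M) = (\<integral>\<^sup>+\<omega>. ennreal (\<tau> \<omega>) \<partial>M)"
    by (rule nn_integral_cong_AE[OF \<tau>_AE])
  show int: "integrable M \<tau>"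
  proof (rule integrableI_nonneg)
    show "AE \<omega> in M. 0 \<le> \<tau> \<omega>" by (simp add: \<tau>_nonneg)
    show "(\<integral>\<^sup>+\<omega>. ennreal (\<tau> \<omega>) \<partial>M) < \<infinity>" using exit_finite_mean by (simp only: eq)
  qed simp
  show "(\<integral>\<^sup>+\<omega>. exit_time X D \<omega> \<partial>M) = ennreal (\<integral>\<omega>. \<tau> \<omega> \<partial>M)"
    unfolding eq by (rule nn_integral_eq_integral[OF int]) (simp add: \<tau>_nonneg)
qed

lemma at_exit_eq: "at_exit X D Y \<omega> = Y (\<tau> \<omega>) \<omega>"
  by (simp add: at_exit_def \<tau>_def)

lemma at_exit_X: "at_exit X D X \<omega> = W (\<tau> \<omega>) \<omega> + X 0 \<omega>"
  by (simp add: at_exit_eq W_def)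

lemma exit_position_mean:
  assumes X: "\<And>t. 0 \<le> t \<Longrightarrow> integrable M (X t)" "\<And>t. 0 \<le> t \<Longrightarrow> (\<integral>\<omega>. X t \<omega> \<partial>M) = t *\<^sub>R c"
  shows "integrable M (at_exit X D X)" and "(\<integral>\<omega>. at_exit X D X \<omega> \<partial>M) = (\<integral>\<omega>. \<tau> \<omega> \<partial>M) *\<^sub>R c"
proof -
  interpret Y: adapted_increments M past "\<lambda>t \<omega>. W t \<omega> - t *\<^sub>R c"
    by (rule W.subtract_drift) (auto simp: scaleR_left_distrib intro!: tendsto_intros)

  have Yi: "integrable M (\<lambda>\<omega>. W t \<omega> - t *\<^sub>R c)" and Y0: "(\<integral>\<omega>. W t \<omega> - t *\<^sub>R c \<partial>M) = 0" if "0 \<le> t" for t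
    using W_moments[OF X(1)[OF that] that] X(2)[OF that] by (simp_all add: prob_space)
  have wald: "integrable M (\<lambda>\<omega>. W (\<tau> \<omega>) \<omega> - \<tau> \<omega> *\<^sub>R c)" "(\<integral>\<omega>. W (\<tau> \<omega>) \<omega> - \<tau> \<omega> *\<^sub>R c \<partial>M) = 0"
    by (rule Y.wald_mean[OF \<tau>_optional \<tau>_integrable Yi Y0]; assumption)+
  have eq: "at_exit X D X = (\<lambda>\<omega>. (W (\<tau> \<omega>) \<omega> - \<tau> \<omega> *\<^sub>R c) + \<tau> \<omega> *\<^sub>R c + X 0 \<omega>)"
    by (rule ext) (simp add: at_exit_X)
  have X0: "integrable M (X 0)" "(\<integral>\<omega>. X 0 \<omega> \<partial>M) = 0" using X[of 0] by auto
  have \<tau>c: "integrable M (\<lambda>\<omega>. \<tau> \<omega> *\<^sub>R c)" using \<tau>_integrable by simp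
  show "integrable M (at_exit X D X)" unfolding eq using wald(1) \<tau>c X0(1) by (intro Bochner_Integration.integrable_add)
  have "(\<integral>\<omega>. at_exit X D X \<omega> \<partial>M) =
      (\<integral>\<omega>. W (\<tau> \<omega>) \<omega> - \<tau> \<omega> *\<^sub>R c \<partial>M) + (\<integral>\<omega>. \<tau> \<omega> *\<^sub>R c \<partial>M) + (\<integral>\<omega>. X 0 \<omega> \<partial>M)"
    unfolding eq
    by (simp only: Bochner_Integration.integral_add[OF Bochner_Integration.integrable_add[OF wald(1) \<tau>c] X0(1)]
        Bochner_Integration.integral_add[OF wald(1) \<tau>c])
  then show "(\<integral>\<omega>. at_exit X D X \<omega> \<partial>M) = (\<integral>\<omega>. \<tau> \<omega> \<partial>M) *\<^sub>R c"
    unfolding wald(2) X0(2) using \<tau>_integrable by simp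
qed

lemma exit_centred_second_moment:
  assumes X: "\<And>t. 0 \<le> t \<Longrightarrow> integrable M (X t)"
    and sq: "\<And>t. 0 \<le> t \<Longrightarrow> integrable M (\<lambda>\<omega>. (norm (X t \<omega> - (\<integral>\<omega>'. X t \<omega>' \<partial>M)))\<^sup>2)"
      "\<And>t. 0 \<le> t \<Longrightarrow> (\<integral>\<omega>. (norm (X t \<omega> - (\<integral>\<omega>'. X t \<omega>' \<partial>M)))\<^sup>2 \<partial>M) = C * t"
  shows "integrable M (\<lambda>\<omega>. (norm (at_exit X D (centred M X) \<omega>))\<^sup>2)"
    and "(\<integral>\<omega>. (norm (at_exit X D (centred M X) \<omega>))\<^sup>2 \<partial>M) = C * (\<integral>\<omega>. \<tau> \<omega> \<partial>M)"
proof -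
  define m where "m t = (\<integral>\<omega>. X t \<omega> \<partial>M)" for t
  have add: "m (s + h) = m s + m h" if "0 \<le> s" "0 \<le> h" for s h
    unfolding m_def by (rule mean_additive[OF X that])
  have X_meas: "X t \<in> borel_measurable M" "W t \<in> borel_measurable M" if "0 \<le> t" for t
    using random_variables that by auto
  have Wsq: "integrable M (\<lambda>\<omega>. (norm (W t \<omega> - m t))\<^sup>2)" "(\<integral>\<omega>. (norm (W t \<omega> - m t))\<^sup>2 \<partial>M) = C * t"
    if t: "0 \<le> t" for t
  proof -
    note [measurable] = X_meas[OF t]
    have eq: "AE \<omega> in M. (norm (W t \<omega> - m t))\<^sup>2 = (norm (X t \<omega> - (\<integral>\<omega>'. X t \<omega>' \<partial>M)))\<^sup>2"
      using W_eq_X_AE by eventually_elim (simp add: m_def)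
    show "integrable M (\<lambda>\<omega>. (norm (W t \<omega> - m t))\<^sup>2)"
      using sq(1)[OF t] integrable_cong_AE[OF _ _ eq] by simp
    show "(\<integral>\<omega>. (norm (W t \<omega> - m t))\<^sup>2 \<partial>M) = C * t"
      unfolding sq(2)[OF t, symmetric] by (rule integral_cong_AE[OF _ _ eq]) simp_all
  qed
  interpret Y: adapted_increments M past "\<lambda>t \<omega>. W t \<omega> - m t"
    by (rule W.subtract_drift[OF add W.mean_right_continuous[OF add Wsq]])
  have Yi: "integrable M (\<lambda>\<omega>. W t \<omega> - m t)" and Y0: "(\<integral>\<omega>. W t \<omega> - m t \<partial>M) = 0" if "0 \<le> t" for t
    using W_moments[OF X[OF that] that] by (simp_all add: prob_space m_def)
  note wald = Y.wald_second_moment[OF \<tau>_optional \<tau>_integrable Yi Y0 Wsq]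
  have [measurable]: "(\<lambda>\<omega>. W (\<tau> \<omega>) \<omega> - m (\<tau> \<omega>)) \<in> borel_measurable M"
    by (rule Y.Z_optional_time_measurable[OF \<tau>_optional])
  have [measurable]: "X 0 \<in> borel_measurable M" using random_variables by simp
  have eq: "at_exit X D (centred M X) = (\<lambda>\<omega>. (W (\<tau> \<omega>) \<omega> - m (\<tau> \<omega>)) + X 0 \<omega>)"
    by (rule ext) (simp add: at_exit_eq centred_def m_def W_def)
  have AE_eq: "AE \<omega> in M. (norm (at_exit X D (centred M X) \<omega>))\<^sup>2 = (norm (W (\<tau> \<omega>) \<omega> - m (\<tau> \<omega>)))\<^sup>2"
    unfolding eq using start_at_0 by eventually_elim simp
  have meas: "(\<lambda>\<omega>. (norm (at_exit X D (centred M X) \<omega>))\<^sup>2) \<in> borel_measurable M"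
    unfolding eq by measurable
  have meas': "(\<lambda>\<omega>. (norm (W (\<tau> \<omega>) \<omega> - m (\<tau> \<omega>)))\<^sup>2) \<in> borel_measurable M" by measurable
  show "integrable M (\<lambda>\<omega>. (norm (at_exit X D (centred M X) \<omega>))\<^sup>2)"
    using integrable_cong_AE[OF meas meas' AE_eq] wald(1) by blast
  show "(\<integral>\<omega>. (norm (at_exit X D (centred M X) \<omega>))\<^sup>2 \<partial>M) = C * (\<integral>\<omega>. \<tau> \<omega> \<partial>M)"
    using integral_cong_AE[OF meas meas' AE_eq] wald(2) by simp
qed

end

theorem theorem9:
  fixes M :: "'w measure"
    and X :: "real \<Rightarrow> 'w \<Rightarrow> 'a::euclidean_space"
    and D :: "'a set"
  assumes "levy_process M X"
    and "open D" and "connected D" and "D \<noteq> {}" and "bounded D"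
    and "exit_time X D \<in> borel_measurable M"
    and "(\<integral>\<^sup>+\<omega>. exit_time X D \<omega> \<partial>M) < \<infinity>"
  shows
    "(\<forall>c. c \<noteq> 0 \<and>
         (\<forall>t\<ge>0. integrable M (X t) \<and> (\<integral>\<omega>. X t \<omega> \<partial>M) = t *\<^sub>R c) \<longrightarrow>
         integrable M (at_exit X D X) \<and>
         (\<integral>\<^sup>+\<omega>. exit_time X D \<omega> \<partial>M) =
           ennreal (1 / norm c * norm (\<integral>\<omega>. at_exit X D X \<omega> \<partial>M))) \<and>
     (\<forall>C. C \<noteq> 0 \<and>
         (\<forall>t\<ge>0. integrable M (X t) \<and>
            integrable M (\<lambda>\<omega>. (norm (X t \<omega> - (\<integral>\<omega>'. X t \<omega>' \<partial>M)))\<^sup>2) \<and>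
            (\<integral>\<omega>. (norm (X t \<omega> - (\<integral>\<omega>'. X t \<omega>' \<partial>M)))\<^sup>2 \<partial>M) = C * t) \<longrightarrow>
         (integrable M (\<lambda>\<omega>. (norm (at_exit X D (centred M X) \<omega>))\<^sup>2) \<and>
          (\<integral>\<^sup>+\<omega>. exit_time X D \<omega> \<partial>M) =
            ennreal (1 / C * (\<integral>\<omega>. (norm (at_exit X D (centred M X) \<omega>))\<^sup>2 \<partial>M))) \<and>
         ((\<forall>t\<ge>0. (\<integral>\<omega>. X t \<omega> \<partial>M) = 0) \<longrightarrow>
          integrable M (at_exit X D X) \<and>
          integrable M (\<lambda>\<omega>. (norm (at_exit X D X \<omega> - (\<integral>\<omega>'. at_exit X D X \<omega>' \<partial>M)))\<^sup>2) \<and>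
          (\<integral>\<^sup>+\<omega>. exit_time X D \<omega> \<partial>M) =
            ennreal (1 / C *
              (\<integral>\<omega>. (norm (at_exit X D X \<omega> - (\<integral>\<omega>'. at_exit X D X \<omega>' \<partial>M)))\<^sup>2 \<partial>M))))"
proof -
  \<comment> \<open>a Euclidean space has positive dimension, so it is unbounded\<close>
  have "D \<noteq> UNIV" using \<open>bounded D\<close> not_bounded_UNIV by auto
  interpret levy_exit M X D
    using assms \<open>D \<noteq> UNIV\<close> by (simp add: levy_exit_def levy_exit_axioms_def)
  have \<tau>0: "0 \<le> (\<integral>\<omega>. \<tau> \<omega> \<partial>M)" by (simp add: \<tau>_nonneg)
  show ?thesis
  proof (rule conjI; intro allI impI; elim conjE)
    fix c :: 'a
    assume c: "c \<noteq> 0" and X: "\<forall>t\<ge>0. integrable M (X t) \<and> (\<integral>\<omega>. X t \<omega> \<partial>M) = t *\<^sub>R c"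
    have Xi: "integrable M (X t)" and Xm: "(\<integral>\<omega>. X t \<omega> \<partial>M) = t *\<^sub>R c" if "0 \<le> t" for t
      using X that by auto
    note pos = exit_position_mean[OF Xi Xm]
    show "integrable M (at_exit X D X) \<and>
         (\<integral>\<^sup>+\<omega>. exit_time X D \<omega> \<partial>M) =
           ennreal (1 / norm c * norm (\<integral>\<omega>. at_exit X D X \<omega> \<partial>M))"
      using pos(1) c \<tau>0 by (simp add: pos(2) exit_mean)
  next
    fix C :: real
    assume C: "C \<noteq> 0" and X: "\<forall>t\<ge>0. integrable M (X t) \<and>
            integrable M (\<lambda>\<omega>. (norm (X t \<omega> - (\<integral>\<omega>'. X t \<omega>' \<partial>M)))\<^sup>2) \<and>
            (\<integral>\<omega>. (norm (X t \<omega> - (\<integral>\<omega>'. X t \<omega>' \<partial>M)))\<^sup>2 \<partial>M) = C * t"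
    have Xi: "integrable M (X t)"
      and sq: "integrable M (\<lambda>\<omega>. (norm (X t \<omega> - (\<integral>\<omega>'. X t \<omega>' \<partial>M)))\<^sup>2)"
        "(\<integral>\<omega>. (norm (X t \<omega> - (\<integral>\<omega>'. X t \<omega>' \<partial>M)))\<^sup>2 \<partial>M) = C * t" if "0 \<le> t" for t
      using X that by auto
    note var = exit_centred_second_moment[OF Xi sq]
    have var': "(\<integral>\<^sup>+\<omega>. exit_time X D \<omega> \<partial>M) =
            ennreal (1 / C * (\<integral>\<omega>. (norm (at_exit X D (centred M X) \<omega>))\<^sup>2 \<partial>M))"
      using C by (simp add: var(2) exit_mean)
    have "integrable M (at_exit X D X) \<and>
          integrable M (\<lambda>\<omega>. (norm (at_exit X D X \<omega> - (\<integral>\<omega>'. at_exit X D X \<omega>' \<partial>M)))\<^sup>2) \<and>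
          (\<integral>\<^sup>+\<omega>. exit_time X D \<omega> \<partial>M) =
            ennreal (1 / C *
              (\<integral>\<omega>. (norm (at_exit X D X \<omega> - (\<integral>\<omega>'. at_exit X D X \<omega>' \<partial>M)))\<^sup>2 \<partial>M))"
      if m0: "\<forall>t\<ge>0. (\<integral>\<omega>. X t \<omega> \<partial>M) = 0"
    proof -
      have Xm: "(\<integral>\<omega>. X t \<omega> \<partial>M) = t *\<^sub>R 0" if "0 \<le> t" for t using m0 that by simp
      note pos = exit_position_mean[OF Xi Xm]
      have mean: "(\<integral>\<omega>. at_exit X D X \<omega> \<partial>M) = 0" using pos(2) by simp
      have eq: "at_exit X D X \<omega> - 0 = at_exit X D (centred M X) \<omega>" for \<omega>
        using m0 \<tau>_nonneg[of \<omega>] by (simp add: at_exit_eq centred_def)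
      show ?thesis unfolding mean eq using pos(1) var(1) var' by blast
    qed
    then show "(integrable M (\<lambda>\<omega>. (norm (at_exit X D (centred M X) \<omega>))\<^sup>2) \<and>
          (\<integral>\<^sup>+\<omega>. exit_time X D \<omega> \<partial>M) =
            ennreal (1 / C * (\<integral>\<omega>. (norm (at_exit X D (centred M X) \<omega>))\<^sup>2 \<partial>M))) \<and>
         ((\<forall>t\<ge>0. (\<integral>\<omega>. X t \<omega> \<partial>M) = 0) \<longrightarrow>
          integrable M (at_exit X D X) \<and>
          integrable M (\<lambda>\<omega>. (norm (at_exit X D X \<omega> - (\<integral>\<omega>'. at_exit X D X \<omega>' \<partial>M)))\<^sup>2) \<and>
          (\<integral>\<^sup>+\<omega>. exit_time X D \<omega> \<partial>M) =
            ennreal (1 / C *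
              (\<integral>\<omega>. (norm (at_exit X D X \<omega> - (\<integral>\<omega>'. at_exit X D X \<omega>' \<partial>M)))\<^sup>2 \<partial>M)))"
      using var(1) var' by blast
  qed
qed

end
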